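(* For every well partial order $X$, $\mathbf{w}(M^{r}(X))=\omega^{\underline{\mathbf{o}}(X)}$.
   Context: A well partial order (wpo) is a partial order with no infinite bad sequence. For a wpo $Y$, the maximal order type $\mathbf{o}(Y)$ is the rank of the empty sequence in the well-founded tree of finite bad sequences of $Y$ (sequences with no $i<j$ such that $y_i\le y_j$), and the width $\mathbf{w}(Y)$ is its rank in the well-founded tree of finite antichains (pairwise incomparable sequences), both trees ordered so that a sequence lies below its proper prefixes (rank $0$ for non-extendable nodes, otherwise the least ordinal exceeding ranks of one-step extensions). $\mathbf{o}(Y)$ is the largest order type of a linear extension of $Y$. $M^{r}(X)$ is the set of finite multisets over $X$ ordered by the multiset ordering: $m\le_r m'$ iff $m=m'$, or for every $x\in m\setminus(m\cap m')$ there is $y\in m'\setminus(m\cap m')$ with $x<y$. Maximal safe order type: for $x\in X$ let $X_{\perp x}=\{y\in X: y\perp x\}$, and for $x_1,\dots,x_n\in X$ let $X_{\not\ge x_1,\dots,x_n}=\{y\in X:y\not\ge x_i\text{ for all } i\}$. A subset $X'\subseteq X$ (with induced order) is safe if there is a maximal linearisation $\ell:X'\to\mathbf{o}(X')$ (an order-preserving bijection onto the ordinal $\mathbf{o}(X')$, i.e. $y<y'\Rightarrow\ell(y)<\ell(y')$) such that for all $x_1,\dots,x_n\in X'$ and all $x\in X'$ with $\ell(x)<\ell(x_i)$ for every $i\in[1,n]$, $(X_{\not\ge x_1,\dots,x_n})_{\perp x}\neq\emptyset$. Then $\underline{\mathbf{o}}(X)=\sup\{\mathbf{o}(X'): X'\subseteq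 X\text{ safe}\}$. *)

theory Defs
  imports Complex_Main "HOL-Library.Multiset"
begin

section \<open>Ordinals\<close>

text \<open>
  Let $\kappa = \max(|A|,\aleph_0)$ where $A$ is the set of all elements of type \<open>'a\<close>; this is the
  cardinality of \<open>'a list\<close>.  The type \<open>'a ordinal\<close> consists of the ordinals below the successor
  cardinal $\kappa^+$; its element \<open>\<alpha>\<close> stands for the order type of \<open>{..<\<alpha>}\<close>.

  No truncation occurs in this type for a well partial order carried by a subset of \<open>'a\<close>, nor for
  the finite multisets over it: the trees of finite sequences involved have at most $\kappa$ nodes,
  so all ranks are below $\kappa^+$, and $\kappa^+$ is closed under suprema of at most $\kappa$
  ordinals (\<open>bdd_above_ordinal\<close>) and under ordinal arithmetic.  The set of maximal order types of
  subsets of a well partial order \<open>X\<close> is bounded by the maximal order type of \<open>X\<close>.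
\<close>

unbundle cardinal_syntax

typedef 'a ordinal = "Field (cardSuc |UNIV :: 'a list set| )"
  using Field_cardSuc_not_empty[OF card_of_Card_order] by blast

instantiation ordinal :: (type) linorder
begin

definition less_eq_ordinal :: "'a ordinal \<Rightarrow> 'a ordinal \<Rightarrow> bool" where
  "a \<le> b \<longleftrightarrow> (Rep_ordinal a, Rep_ordinal b) \<in> cardSuc |UNIV :: 'a list set|"

definition less_ordinal :: "'a ordinal \<Rightarrow> 'a ordinal \<Rightarrow> bool" where
  "a < b \<longleftrightarrow> a \<le> b \<and> \<not> b \<le> (a :: 'a ordinal)"

instance
proof -
  interpret wo_rel "cardSuc |UNIV :: 'a list set|"
    by (rule Card_order_wo_rel[OF cardSuc_Card_order[OF card_of_Card_order]])
  show "OFCLASS('a ordinal, linorder_class)"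
  proof
    fix a b c :: "'a ordinal"
    show "a < b \<longleftrightarrow> a \<le> b \<and> \<not> b \<le> a"
      by (fact less_ordinal_def)
    show "a \<le> a"
      unfolding less_eq_ordinal_def by (rule refl_onD[OF REFL Rep_ordinal])
    show "a \<le> b \<Longrightarrow> b \<le> c \<Longrightarrow> a \<le> c"
      unfolding less_eq_ordinal_def by (rule transD[OF TRANS])
    show "a \<le> b \<Longrightarrow> b \<le> a \<Longrightarrow> a = b"
      unfolding less_eq_ordinal_def by (metis antisymD[OF ANTISYM] Rep_ordinal_inject)
    show "a \<le> b \<or> b \<le> a"
      unfolding less_eq_ordinal_def using TOTALS Rep_ordinal by blast
  qed
qed

end

instance ordinal :: (type) wellorder
proof
  interpret wo_rel "cardSuc |UNIV :: 'a list set|"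
    by (rule Card_order_wo_rel[OF cardSuc_Card_order[OF card_of_Card_order]])
  fix P :: "'a ordinal \<Rightarrow> bool" and a
  assume step: "\<And>x. (\<And>y. y < x \<Longrightarrow> P y) \<Longrightarrow> P x"
  have "wf (inv_image (cardSuc |UNIV :: 'a list set| - Id) (Rep_ordinal :: 'a ordinal \<Rightarrow> _))"
    by (rule wf_inv_image[OF WF])
  then show "P a"
  proof (induction a rule: wf_induct_rule)
    case (less x)
    show ?case
      by (rule step, rule less)
        (auto simp: less_ordinal_def less_eq_ordinal_def Rep_ordinal_inject)
  qed
qed

lemma bdd_above_ordinal:
  fixes A :: "'a ordinal set"
  assumes "|A| \<le>o |UNIV :: 'a list set|"
  shows "\<exists>b. \<forall>a\<in>A. a < b"
proof (rule ccontr)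
  let ?r = "cardSuc |UNIV :: 'a list set|"
  assume "\<not> ?thesis"
  then have *: "\<exists>a\<in>A. b \<le> a" for b
    by (meson not_less)
  have inf: "\<not> finite (Field |UNIV :: 'a list set| )"
    by (simp add: Field_card_of infinite_UNIV_listI)
  have card: "Card_order ?r"
    by (rule cardSuc_Card_order[OF card_of_Card_order])
  have "cofinal (Rep_ordinal ` A) ?r"
    unfolding cofinal_def
  proof
    fix x assume x: "x \<in> Field ?r"
    obtain y where y: "y \<in> Field ?r" "x \<noteq> y" "(x, y) \<in> ?r"
      using infinite_Card_order_limit[OF card _ x] inf cardSuc_finite[OF card_of_Card_order] by blast
    obtain a where a: "a \<in> A" "Abs_ordinal y \<le> a"
      using * by blast
    have xy: "Abs_ordinal x < Abs_ordinal y"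
      using x y by (auto simp: less_le less_eq_ordinal_def Abs_ordinal_inverse Abs_ordinal_inject)
    then have "Abs_ordinal x < a"
      using a by order
    then show "\<exists>b\<in>Rep_ordinal ` A. x \<noteq> b \<and> (x, b) \<in> ?r"
      using a(1) x by (auto simp: less_le less_eq_ordinal_def Abs_ordinal_inverse Rep_ordinal_inverse)
  qed
  moreover have "regularCard ?r"
    by (rule infinite_cardSuc_regularCard[OF inf card_of_Card_order])
  moreover have "Rep_ordinal ` A \<subseteq> Field ?r"
    using Rep_ordinal by blast
  ultimately have "|Rep_ordinal ` A| =o ?r"
    unfolding regularCard_def by blast
  moreover have "|Rep_ordinal ` A| \<le>o |UNIV :: 'a list set|"
    by (rule ordLeq_transitive[OF card_of_image assms])
  ultimately have "?r \<le>o |UNIV :: 'a list set|"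
    using ordIso_ordLeq_trans ordIso_symmetric by blast
  then show False
    using cardSuc_greater[OF card_of_Card_order] not_ordLess_ordLeq by blast
qed

lemma bdd_above_image_lessThan_ordinal:
  fixes f :: "'a ordinal \<Rightarrow> 'a ordinal"
  shows "\<exists>c. \<forall>a\<in>f ` {..<b}. a < c"
proof (rule bdd_above_ordinal)
  let ?r = "cardSuc |UNIV :: 'a list set|"
  have "Rep_ordinal ` {..<b} \<subseteq> underS ?r (Rep_ordinal b)"
    by (auto simp: underS_def less_le less_eq_ordinal_def Rep_ordinal_inject)
  then have "|{..<b}| \<le>o |underS ?r (Rep_ordinal b)|"
    by (intro card_of_ordLeqI[of Rep_ordinal] inj_onI) (auto simp: Rep_ordinal_inject)
  moreover have "|underS ?r (Rep_ordinal b)| <o ?r"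
    by (rule card_of_underS[OF cardSuc_Card_order[OF card_of_Card_order] Rep_ordinal])
  ultimately have "|{..<b}| <o ?r"
    by (rule ordLeq_ordLess_trans)
  then have "|{..<b}| \<le>o |UNIV :: 'a list set|"
    by (simp only: cardSuc_ordLeq_ordLess[OF card_of_Card_order card_of_Card_order])
  then show "|f ` {..<b}| \<le>o |UNIV :: 'a list set|"
    by (rule ordLeq_transitive[OF card_of_image])
qed

instantiation ordinal :: (type) order_bot
begin

definition bot_ordinal :: "'a ordinal" where
  "bot_ordinal = (LEAST a. True)"

instance
  by standard (simp add: bot_ordinal_def Least_le)

end

instantiation ordinal :: (type) conditionally_complete_linorder
begin

definition inf_ordinal :: "'a ordinal \<Rightarrow> 'a ordinal \<Rightarrow> 'a ordinal" where
  "inf_ordinal = min"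

definition sup_ordinal :: "'a ordinal \<Rightarrow> 'a ordinal \<Rightarrow> 'a ordinal" where
  "sup_ordinal = max"

definition Inf_ordinal :: "'a ordinal set \<Rightarrow> 'a ordinal" where
  "Inf_ordinal A = (LEAST a. a \<in> A)"

definition Sup_ordinal :: "'a ordinal set \<Rightarrow> 'a ordinal" where
  "Sup_ordinal A = (LEAST b. \<forall>a\<in>A. a \<le> b)"

instance
proof
  fix a b c :: "'a ordinal" and A :: "'a ordinal set"
  show "inf a b \<le> a" "inf a b \<le> b" "a \<le> sup a b" "b \<le> sup a b"
    by (simp_all add: inf_ordinal_def sup_ordinal_def)
  show "a \<le> b \<Longrightarrow> a \<le> c \<Longrightarrow> a \<le> inf b c" "b \<le> a \<Longrightarrow> c \<le> a \<Longrightarrow> sup b c \<le> a"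
    by (simp_all add: inf_ordinal_def sup_ordinal_def)
  show "Inf A \<le> a" if "a \<in> A"
    using that unfolding Inf_ordinal_def by (rule Least_le)
  show "c \<le> Inf A" if "A \<noteq> {}" "\<And>a. a \<in> A \<Longrightarrow> c \<le> a"
    using that unfolding Inf_ordinal_def by (metis LeastI all_not_in_conv)
  show "a \<le> Sup A" if *: "a \<in> A" "bdd_above A"
  proof -
    obtain u where "\<forall>a\<in>A. a \<le> u"
      using *(2) by (auto simp: bdd_above_def)
    then have "\<forall>a\<in>A. a \<le> Sup A"
      unfolding Sup_ordinal_def by (rule LeastI)
    with *(1) show ?thesis by blast
  qed
  show "Sup A \<le> c" if "\<And>a. a \<in> A \<Longrightarrow> a \<le> c"
    unfolding Sup_ordinal_def using that by (intro Least_le) blast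
qed

end

lemma Sup_empty_ordinal: "Sup {} = (bot :: 'a ordinal)"
  by (simp add: Sup_ordinal_def bot_ordinal_def)

definition osuc :: "'a ordinal \<Rightarrow> 'a ordinal" where
  "osuc a = (LEAST b. a < b)"

instantiation ordinal :: (type) "{zero, one}"
begin

definition zero_ordinal :: "'a ordinal" where
  "zero_ordinal = bot"

definition one_ordinal :: "'a ordinal" where
  "one_ordinal = osuc 0"

instance ..

end

definition omega :: "'a ordinal" where
  "omega = (SUP n. (osuc ^^ n) 0)"

context notes image_cong [fundef_cong]
begin

function oadd :: "'a ordinal \<Rightarrow> 'a ordinal \<Rightarrow> 'a ordinal" where
  "oadd a b = Sup (insert a ((\<lambda>b'. osuc (oadd a b')) ` {..<b}))"
  by pat_completeness simp
termination
  by (relation "inv_image {(x, y). x < y} snd", rule wf_inv_image, rule wf, simp)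

declare oadd.simps [simp del]

function omult :: "'a ordinal \<Rightarrow> 'a ordinal \<Rightarrow> 'a ordinal" where
  "omult a b = Sup ((\<lambda>b'. oadd (omult a b') a) ` {..<b})"
  by pat_completeness simp
termination
  by (relation "inv_image {(x, y). x < y} snd", rule wf_inv_image, rule wf, simp)

declare omult.simps [simp del]

function omega_power :: "'a ordinal \<Rightarrow> 'a ordinal" where
  "omega_power b = Sup (insert 1 ((\<lambda>b'. omult (omega_power b') omega) ` {..<b}))"
  by pat_completeness simp
termination
  by (relation "{(x, y). x < y}", rule wf, simp)

end

declare omega_power.simps [simp del]

lemma zero_le_ordinal [simp]: "0 \<le> (a :: 'a ordinal)"
  by (simp add: zero_ordinal_def)

lemma less_osuc [simp]: "a < osuc a"
proof -
  obtain b where "a < b"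
    using bdd_above_ordinal[of "{a}"] card_of_singl_ordLeq[of "UNIV :: 'a list set" a] by auto
  then show ?thesis
    unfolding osuc_def by (rule LeastI)
qed

lemma osuc_le_iff [simp]: "osuc a \<le> b \<longleftrightarrow> a < b"
  using less_osuc[of a] by (auto simp: osuc_def intro: Least_le elim: order.strict_trans2)

lemma less_osuc_iff [simp]: "a < osuc b \<longleftrightarrow> a \<le> b"
  by (metis not_le osuc_le_iff)

lemma bdd_above_image_lessThan [simp]:
  fixes f :: "'a ordinal \<Rightarrow> 'a ordinal"
  shows "bdd_above (f ` {..<b})"
  using bdd_above_image_lessThan_ordinal[of f b] unfolding bdd_above_def by (meson less_imp_le)

lemma lessThan_zero_ordinal [simp]: "{..<0 :: 'a ordinal} = {}"
  using zero_le_ordinal by (auto simp: lessThan_def not_less[symmetric] simp del: zero_le_ordinal)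

lemma lessThan_osuc: "{..<osuc b} = insert b {..<b}"
  by auto

lemma oadd_zero: "oadd a 0 = a"
  by (simp add: oadd.simps[of a 0])

lemma oadd_osuc: "oadd a (osuc b) = osuc (oadd a b)"
proof (rule antisym)
  have *: "insert a ((\<lambda>b'. osuc (oadd a b')) ` {..<osuc b}) =
    insert (osuc (oadd a b)) (insert a ((\<lambda>b'. osuc (oadd a b')) ` {..<b}))"
    by (auto simp: lessThan_osuc)
  have up: "x \<le> oadd a b" if "x \<in> insert a ((\<lambda>b'. osuc (oadd a b')) ` {..<b})" for x
    unfolding oadd.simps[of a b] using that by (rule cSup_upper) simp
  show "oadd a (osuc b) \<le> osuc (oadd a b)"
    unfolding oadd.simps[of a "osuc b"] *
  proof (rule cSup_least)
    fix x assume "x \<in> insert (osuc (oadd a b)) (insert a ((\<lambda>b'. osuc (oadd a b')) ` {..<b}))"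
    then consider "x = osuc (oadd a b)" | "x \<le> oadd a b"
      using up by blast
    then show "x \<le> osuc (oadd a b)"
      by cases (simp_all add: less_imp_le order.strict_trans1[OF _ less_osuc])
  qed simp
  show "osuc (oadd a b) \<le> oadd a (osuc b)"
    unfolding oadd.simps[of a "osuc b"] by (rule cSup_upper) (simp_all add: lessThan_osuc)
qed

lemma le_oadd: "a \<le> oadd a b"
  unfolding oadd.simps[of a b] by (rule cSup_upper) simp_all

lemma oadd_zero_left: "oadd 0 b = b"
proof (induction b rule: less_induct)
  case (less b)
  have "insert 0 ((\<lambda>b'. osuc (oadd 0 b')) ` {..<b}) = insert 0 (osuc ` {..<b})"
    using less by auto
  moreover have "Sup (insert 0 (osuc ` {..<b})) = b"
  proof (rule antisym)
    show "Sup (insert 0 (osuc ` {..<b})) \<le> b"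
      by (rule cSup_least) auto
    show "b \<le> Sup (insert 0 (osuc ` {..<b}))"
    proof (rule ccontr)
      assume "\<not> ?thesis"
      then have "osuc (Sup (insert 0 (osuc ` {..<b}))) \<le> Sup (insert 0 (osuc ` {..<b}))"
        by (intro cSup_upper) simp_all
      then show False
        by simp
    qed
  qed
  ultimately show ?case
    by (simp add: oadd.simps[of 0 b])
qed

lemma omult_zero: "omult a 0 = 0"
  by (simp add: omult.simps[of a 0] Sup_empty_ordinal zero_ordinal_def[symmetric])

lemma omult_upper: "b' < b \<Longrightarrow> oadd (omult a b') a \<le> omult a b"
  unfolding omult.simps[of a b] by (rule cSup_upper) simp_all

lemma omult_osuc: "omult a (osuc b) = oadd (omult a b) a"
proof (rule antisym)
  show "omult a (osuc b) \<le> oadd (omult a b) a"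
    unfolding omult.simps[of a "osuc b"]
  proof (rule cSup_least)
    fix x assume "x \<in> (\<lambda>b'. oadd (omult a b') a) ` {..<osuc b}"
    then consider "x = oadd (omult a b) a" | "x \<le> omult a b"
      by (auto simp: lessThan_osuc omult_upper)
    then show "x \<le> oadd (omult a b) a"
      by cases (auto intro: order.trans le_oadd)
  qed (simp add: lessThan_osuc)
qed (simp add: omult_upper)

lemma zero_less_omega: "0 < (omega :: 'a ordinal)"
proof -
  have "|range (\<lambda>n. (osuc ^^ n) (0 :: 'a ordinal))| \<le>o |UNIV :: 'a list set|"
    using card_of_image infinite_iff_card_of_nat infinite_UNIV_listI ordLeq_transitive by blast
  then have "bdd_above (range (\<lambda>n. (osuc ^^ n) (0 :: 'a ordinal)))"
    using bdd_above_ordinal by (meson bdd_above.I less_imp_le)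
  then have "(osuc ^^ 1) 0 \<le> (omega :: 'a ordinal)"
    unfolding omega_def by (intro cSUP_upper) auto
  then show ?thesis
    by simp
qed

lemma omega_power_zero: "omega_power 0 = 1"
  by (simp add: omega_power.simps[of 0])

lemma omega_power_osuc: "omega_power (osuc b) = omult (omega_power b) omega"
proof (rule antisym)
  have le: "omega_power b \<le> omult (omega_power b) omega"
    using omult_upper[OF zero_less_omega, of "omega_power b"] by (simp add: omult_zero oadd_zero_left)
  have up: "x \<le> omega_power b"
    if "x \<in> insert 1 ((\<lambda>b'. omult (omega_power b') omega) ` {..<b})" for x
    unfolding omega_power.simps[of b] using that
    by (rule cSup_upper) simp
  show "omega_power (osuc b) \<le> omult (omega_power b) omega"
    unfolding omega_power.simps[of "osuc b"]
  proof (rule cSup_least)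
    fix x assume "x \<in> insert 1 ((\<lambda>b'. omult (omega_power b') omega) ` {..<osuc b})"
    then consider "x = omult (omega_power b) omega" | "x \<le> omega_power b"
      using up by (auto simp: lessThan_osuc)
    then show "x \<le> omult (omega_power b) omega"
      using le by cases auto
  qed simp
  show "omult (omega_power b) omega \<le> omega_power (osuc b)"
    unfolding omega_power.simps[of "osuc b"]
    by (rule cSup_upper) (simp_all add: lessThan_osuc)
qed


section \<open>Well partial orders, maximal order type and width\<close>

text \<open>A partial order is given by its carrier and its (reflexive) order predicate, whose values
  outside the carrier are irrelevant.\<close>

definition wpo_on :: "'a set \<Rightarrow> ('a \<Rightarrow> 'a \<Rightarrow> bool) \<Rightarrow> bool" where
  "wpo_on X le \<longleftrightarrow> reflp_on X le \<and> antisymp_on X le \<and> transp_on X le \<and>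
    (\<forall>f :: nat \<Rightarrow> 'a. range f \<subseteq> X \<longrightarrow> (\<exists>i j. i < j \<and> le (f i) (f j)))"

definition incomparable :: "('a \<Rightarrow> 'a \<Rightarrow> bool) \<Rightarrow> 'a \<Rightarrow> 'a \<Rightarrow> bool" where
  "incomparable le x y \<longleftrightarrow> \<not> le x y \<and> \<not> le y x"

definition bad_seqs :: "'a set \<Rightarrow> ('a \<Rightarrow> 'a \<Rightarrow> bool) \<Rightarrow> 'a list set" where
  "bad_seqs X le = {s. set s \<subseteq> X \<and> sorted_wrt (\<lambda>x y. \<not> le x y) s}"

definition antichain_seqs :: "'a set \<Rightarrow> ('a \<Rightarrow> 'a \<Rightarrow> bool) \<Rightarrow> 'a list set" where
  "antichain_seqs X le = {s. set s \<subseteq> X \<and> sorted_wrt (incomparable le) s}"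

definition one_step_ext :: "'a list set \<Rightarrow> ('a list \<times> 'a list) set" where
  "one_step_ext T = {(s @ [x], s) | s x. s \<in> T \<and> s @ [x] \<in> T}"

text \<open>The rank of a node is the least ordinal exceeding the ranks of its one-step extensions in
  the tree \<open>T\<close>, in particular \<open>0\<close> for a node without extensions.  It is meaningful when
  \<open>one_step_ext T\<close> is well-founded and the ordinals \<open>'o\<close> are large enough.  The type \<open>'o\<close> is not
  tied to the type of the sequences, so that trees over different types can be compared.\<close>

definition tree_rank :: "'a list set \<Rightarrow> 'a list \<Rightarrow> 'o::wellorder" where
  "tree_rank T = wfrec (one_step_ext T)
     (\<lambda>rk s. LEAST \<alpha>. \<forall>t. (t, s) \<in> one_step_ext T \<longrightarrow> rk t < \<alpha>)"

definition max_order_type :: "'a set \<Rightarrow> ('a \<Rightarrow> 'a \<Rightarrow> bool) \<Rightarrow> 'o::wellorder" where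
  "max_order_type X le = tree_rank (bad_seqs X le) []"

definition width :: "'a set \<Rightarrow> ('a \<Rightarrow> 'a \<Rightarrow> bool) \<Rightarrow> 'o::wellorder" where
  "width X le = tree_rank (antichain_seqs X le) []"


section \<open>The multiset ordering\<close>

definition multiset_le :: "('a \<Rightarrow> 'a \<Rightarrow> bool) \<Rightarrow> 'a multiset \<Rightarrow> 'a multiset \<Rightarrow> bool" where
  "multiset_le le m m' \<longleftrightarrow> m = m' \<or>
    (\<forall>x \<in># m - (m \<inter># m'). \<exists>y \<in># m' - (m \<inter># m'). le x y \<and> x \<noteq> y)"


section \<open>Maximal safe order type\<close>

definition incomparable_part :: "'a set \<Rightarrow> ('a \<Rightarrow> 'a \<Rightarrow> bool) \<Rightarrow> 'a \<Rightarrow> 'a set" where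
  "incomparable_part X le x = {y \<in> X. incomparable le y x}"

definition not_above_part :: "'a set \<Rightarrow> ('a \<Rightarrow> 'a \<Rightarrow> bool) \<Rightarrow> 'a list \<Rightarrow> 'a set" where
  "not_above_part X le xs = {y \<in> X. \<forall>x \<in> set xs. \<not> le x y}"

definition max_linearisation ::
    "'a set \<Rightarrow> ('a \<Rightarrow> 'a \<Rightarrow> bool) \<Rightarrow> ('a \<Rightarrow> 'a ordinal) \<Rightarrow> bool" where
  "max_linearisation X le l \<longleftrightarrow> bij_betw l X {..<max_order_type X le} \<and>
    (\<forall>y\<in>X. \<forall>y'\<in>X. le y y' \<and> y \<noteq> y' \<longrightarrow> l y < l y')"

text \<open>The list \<open>xs\<close> of the elements $x_1, \dots, x_n$ may be empty; for $n = 0$ the condition says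
  that no element of \<open>X'\<close> is comparable to all of \<open>X\<close>.\<close>

definition safe :: "'a set \<Rightarrow> ('a \<Rightarrow> 'a \<Rightarrow> bool) \<Rightarrow> 'a set \<Rightarrow> bool" where
  "safe X le X' \<longleftrightarrow> X' \<subseteq> X \<and> (\<exists>l. max_linearisation X' le l \<and>
    (\<forall>xs x. set xs \<subseteq> X' \<and> x \<in> X' \<and> (\<forall>y \<in> set xs. l x < l y) \<longrightarrow>
      incomparable_part (not_above_part X le xs) le x \<noteq> {}))"

definition max_safe_order_type :: "'a set \<Rightarrow> ('a \<Rightarrow> 'a \<Rightarrow> bool) \<Rightarrow> 'a ordinal" where
  "max_safe_order_type X le = Sup {max_order_type X' le | X'. safe X le X'}"

end

theory Submission
  imports Defs "HOL-Library.Multiset_Order"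
begin

text \<open>
  The natural sum of ordinals is the sum of multisets of ordinals: reading \<open>{#a\<^sub>1, \<dots>, a\<^sub>n#}\<close> as
  $\omega^{a_1} \oplus \dots \oplus \omega^{a_n}$ turns the multiset ordering on multisets of ordinals
  into the ordering of ordinals.  All ranks are computed in this form; \<open>multiset_rank\<close> translates
  them back.

  Call $y$ a friend of $x$ if $x \perp y$, and let the friendly rank $r(X)$ be the rank of the tree of
  bad sequences in which every $x_n$ has a friend in $X_{\not\ge x_1, \dots, x_{n-1}}$.  Then
  $\mathbf{w}(M^r(X)) = \omega^{r(X)}$.  If $n \perp m$, then for some $x \in m$ with a friend, $n$ is the
  sum of a part of $m$ and of a multiset over $X_{\not\ge x}$, so the residual at $m$ is a finite union
  of copies of $M^r(X_{\not\ge x})$, and finite unions have at most the natural sum of the widths.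
  Conversely, if $x$ has the friend $y$, one can play an antichain over $X_{\not\ge x}$ shifted by
  $x^k$, then another one shifted by $x^{k-1} z^N$ for some $z \ge y$ and large $N$, and so on $k$ times.

  A safe set of type $\alpha$ yields $r(X) \ge \alpha$, as decreasing sequences of its linearisation are
  friendly bad sequences.  The converse, a safe set of type $r(X)$, is found by induction on the
  Cantor normal form of $r$, relativised to bad sequences in a subset $E$ of $X$.  A rank $\beta + \omega^a$
  is split by some $x \in E$ into safe sets of type $\beta$ in $E_{\not\ge x}$ and of type $\omega^a$ above
  $x$.  For $\omega^a$ one of three subsets on which every bad sequence is friendly carries the whole
  rank; there the linearisation is built as in the theorem of de Jongh and Parikh.
\<close>

section \<open>Multisets of ordinals\<close>

abbreviation small :: "'b set \<Rightarrow> 'a itself \<Rightarrow> bool" where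
  "small A (a :: 'a itself) \<equiv> |A| \<le>o |UNIV :: 'a list set|"

lemma small_nat: "small (UNIV :: nat set) TYPE('a)"
  using infinite_iff_card_of_nat infinite_UNIV_listI by blast

lemma small_UN:
  assumes "small I TYPE('a)" "\<And>i. i \<in> I \<Longrightarrow> small (A i) TYPE('a)"
  shows "small (\<Union>i\<in>I. A i) TYPE('a)"
  by (rule card_of_UNION_ordLeq_infinite) (use assms infinite_UNIV_listI in blast)+

lemma small_image: "small A TYPE('a) \<Longrightarrow> small (f ` A) TYPE('a)"
  by (rule ordLeq_transitive[OF card_of_image])

lemma small_subset: "small A TYPE('a) \<Longrightarrow> B \<subseteq> A \<Longrightarrow> small B TYPE('a)"
  by (rule ordLeq_transitive[OF card_of_mono1])

lemma small_Un:
  assumes "small A TYPE('a)" "small B TYPE('a)"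
  shows "small (A \<union> B) TYPE('a)"
proof -
  have "small (UNIV :: bool set) TYPE('a)"
    by (rule card_of_ordLeqI[of "\<lambda>b. if b then [] else [undefined]"]) (auto intro!: injI split: if_splits)
  then have "small (\<Union>b. if b then A else B) TYPE('a)"
    by (rule small_UN) (use assms in auto)
  then show ?thesis
    by (simp add: UNIV_bool Un_commute)
qed

lemma small_insert: "small A TYPE('a) \<Longrightarrow> small (insert x A) TYPE('a)"
  using small_Un[of "{x}" A] by (simp add: card_of_singl_ordLeq)

lemma small_UNIV: "small (UNIV :: 'a set) TYPE('a)"
  by (rule card_of_ordLeqI[of "\<lambda>x. [x]"]) (auto intro: inj_onI)

lemma small_UNIV_multiset: "small (UNIV :: 'a multiset set) TYPE('a)"
proof -
  have "(UNIV :: 'a multiset set) = mset ` UNIV"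
    by (metis surj_def ex_mset)
  then show ?thesis
    by (metis card_of_image)
qed

lemma small_lessThan: "small {..<b :: 'a ordinal} TYPE('a)"
proof -
  let ?r = "cardSuc |UNIV :: 'a list set|"
  have "Rep_ordinal ` {..<b} \<subseteq> underS ?r (Rep_ordinal b)"
    by (auto simp: underS_def less_le less_eq_ordinal_def Rep_ordinal_inject)
  then have "|{..<b}| \<le>o |underS ?r (Rep_ordinal b)|"
    by (intro card_of_ordLeqI[of Rep_ordinal] inj_onI) (auto simp: Rep_ordinal_inject)
  moreover have "|underS ?r (Rep_ordinal b)| <o ?r"
    by (rule card_of_underS[OF cardSuc_Card_order[OF card_of_Card_order] Rep_ordinal])
  ultimately have "|{..<b}| <o ?r"
    by (rule ordLeq_ordLess_trans)
  then show ?thesis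
    by (simp only: cardSuc_ordLeq_ordLess[OF card_of_Card_order card_of_Card_order])
qed

lemma small_bounded_multiset:
  fixes A :: "'a ordinal multiset set"
  assumes "small A TYPE('a)"
  shows "\<exists>M. \<forall>N\<in>A. N < M"
proof -
  obtain b where b: "\<And>N. N \<in> A \<Longrightarrow> Max (set_mset N) < b"
    using bdd_above_ordinal[OF small_image[OF assms, of "\<lambda>N. Max (set_mset N)"]] by auto
  have "N < {#b#}" if "N \<in> A" for N
    using b[OF that] by (auto intro: le_less_trans[OF Max_ge])
  then show ?thesis by blast
qed

text \<open>Left subtraction of Cantor normal forms: as no entry of \<open>N\<close> exceeds one of
  \<open>M\<close>, \<open>M + N\<close> is the ordinary ordinal sum. If \<open>K\<close> lacked a
  part of \<open>M\<close>, then \<open>M \<le> K\<close> would force a surplus entry in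
  \<open>K\<close> above that part and above all of \<open>N\<close>, so \<open>K\<close> would
  exceed \<open>M + N\<close>.\<close>

lemma ordinal_multiset_remainder:
  fixes M N K :: "'o::wellorder multiset"
  assumes MN: "\<And>x y. x \<in># M \<Longrightarrow> y \<in># N \<Longrightarrow> y \<le> x" and K: "M \<le> K" "K < M + N"
  obtains N' where "K = M + N'" "N' < N"
proof -
  let ?C = "K \<inter># M"
  have "M - ?C = {#}"
  proof (rule ccontr)
    assume ne: "M - ?C \<noteq> {#}"
    have eq: "K = ?C + (K - ?C)" "M = ?C + (M - ?C)"
      by (rule multiset_eqI, simp add: min_def)+
    then have "?C + (M - ?C) \<le> ?C + (K - ?C)"
      using K(1) by simp
    then have "M - ?C \<le> K - ?C"
      by simp
    moreover have "(M - ?C) \<inter># (K - ?C) = {#}"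
      by (rule multiset_eqI) (simp add: min_def)
    then have "M - ?C \<noteq> K - ?C"
      using ne by auto
    ultimately have lt: "M - ?C < K - ?C"
      by simp
    let ?m = "Max_mset (M - ?C)"
    have m: "?m \<in># M - ?C"
      using ne by simp
    then have "count (K - ?C) ?m < count (M - ?C) ?m"
      by (auto simp: in_diff_count)
    then obtain k where k: "k > ?m" "count (M - ?C) k < count (K - ?C) k"
      using lt unfolding less_multiset\<^sub>H\<^sub>O by blast
    have "k \<in># K - ?C"
      by (rule count_inI) (use k(2) in simp)
    moreover have "x < k" if "x \<in># M - ?C + N" for x
    proof -
      have "x \<le> ?m"
        using that MN[OF in_diffD[OF m]] by auto
      with k(1) show ?thesis by simp
    qed
    ultimately have "M - ?C + N < K - ?C"
      by (blast intro: ex_gt_imp_less_multiset)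
    then have "(?C + (M - ?C)) + N < ?C + (K - ?C)"
      by (simp only: add.assoc add_less_cancel_left)
    then show False
      unfolding eq[symmetric] using K(2) by simp
  qed
  then have "M \<subseteq># ?C"
    by (simp add: Diff_eq_empty_iff_mset)
  then have "M \<subseteq># K"
    by simp
  then obtain N' where N': "K = M + N'"
    by (auto simp: subset_mset.le_iff_add)
  then show thesis
    using that K(2) by simp
qed

lemma lessThan_ordinal_multiset_add:
  fixes M N :: "'o::wellorder multiset"
  assumes "\<And>x y. x \<in># M \<Longrightarrow> y \<in># N \<Longrightarrow> y \<le> x"
  shows "{..<M + N} = {..<M} \<union> (+) M ` {..<N}"
proof (intro equalityI subsetI)
  fix K assume "K \<in> {..<M + N}"
  then have K: "K < M + N"
    by simp
  show "K \<in> {..<M} \<union> (+) M ` {..<N}"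
  proof (cases "M \<le> K")
    case True
    obtain N' where "K = M + N'" "N' < N"
      by (rule ordinal_multiset_remainder[OF assms True K])
    then show ?thesis by blast
  qed (simp add: not_le)
qed (auto intro: order.strict_trans2[OF _ less_eq_multiset_plus_left] simp: add.commute[of M N])

lemma not_less_zero_ordinal [simp]: "\<not> a < (0 :: 'a ordinal)"
  by (simp add: not_less)

text \<open>Since \<omega>^0 = 1, \<open>N + {#0#}\<close> is the successor of
  \<open>N\<close>.\<close>

lemma add_zero_mset_le:
  fixes M N :: "'a ordinal multiset"
  assumes "N < M"
  shows "N + {#0#} \<le> M"
proof (rule ccontr)
  assume "\<not> ?thesis"
  then have M: "M < N + {#0#}"
    by simp
  obtain N' where N': "M = N + N'" "N' < {#0#}"
    by (rule ordinal_multiset_remainder[OF _ less_imp_le[OF assms] M]) auto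
  then have "N' = {#}"
    by (cases N') auto
  then show False
    using assms N' by simp
qed

text \<open>A normal form lies below a finite multiple of \<omega>^c; one copy more than its size
  makes the bound strict.\<close>

lemma less_replicate_mset:
  fixes N :: "'o::linorder multiset"
  assumes "\<And>x. x \<in># N \<Longrightarrow> x \<le> c"
  shows "N < replicate_mset (Suc (size N)) c"
  unfolding less_multiset\<^sub>H\<^sub>O
proof (intro conjI allI impI)
  have *: "count N c < Suc (size N)"
    by (simp add: count_le_size le_imp_less_Suc)
  then show "N \<noteq> replicate_mset (Suc (size N)) c"
    by (metis count_replicate_mset less_irrefl)
  fix y assume y: "count (replicate_mset (Suc (size N)) c) y < count N y"
  with * have "y \<noteq> c"
    by (auto simp del: replicate_mset_Suc)
  moreover from y have "y \<in># N"
    by (metis count_inI not_less_zero)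
  ultimately have "y < c"
    using assms by (simp add: order.not_eq_order_implies_strict)
  with * show "\<exists>x>y. count N x < count (replicate_mset (Suc (size N)) c) x"
    by (intro exI[of _ c]) (simp del: replicate_mset_Suc)
qed

text \<open>The order isomorphism from normal forms onto an initial segment of the ordinals.
  Bounding the quantifier by \<open>{..<M}\<close> lets the termination argument see that the
  recursion descends.\<close>

function multiset_rank :: "'a ordinal multiset \<Rightarrow> 'a ordinal" where
  "multiset_rank M = (LEAST b. \<forall>N\<in>{..<M}. \<forall>c\<in>{multiset_rank N}. c < b)"
  by pat_completeness simp
termination
  by (relation "{(x, y). x < y}", rule wf, simp)

declare multiset_rank.simps [simp del]

text \<open>Needed for the least bound in \<open>multiset_rank\<close> to exist. With
  \<open>a\<close> the least entry, the predecessors of \<open>B + {#a#}\<close> are those of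
  \<open>B\<close> and translates of those of \<open>{#a#}\<close>, and a nonempty predecessor of
  \<open>{#a#}\<close> lies below some finite multiple of \<omega>^c with c < a.\<close>

lemma small_lessThan_multiset:
  fixes M :: "'a ordinal multiset"
  shows "small {..<M} TYPE('a)"
proof (induction M rule: less_induct)
  case (less M)
  show ?case
  proof (cases "M = {#}")
    case True
    then show ?thesis
      by (simp add: lessThan_def card_of_empty)
  next
    case False
    define a where "a = Min_mset M"
    define B where "B = M - {#a#}"
    have M: "M = B + {#a#}" and a: "\<And>x. x \<in># B \<Longrightarrow> a \<le> x"
      using False by (auto simp: a_def B_def dest: in_diffD)
    show ?thesis
    proof (cases "B = {#}")
      case True
      let ?U = "insert {#} (\<Union>c\<in>{..<a}. \<Union>n. {..<replicate_mset n c})"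
      have "N \<in> ?U" if "N < M" for N
      proof (cases "N = {#}")
        case False
        let ?c = "Max_mset N"
        have "N < replicate_mset (Suc (size N)) ?c"
          by (rule less_replicate_mset) simp
        moreover have "?c < a"
          using that False True M by auto
        ultimately show ?thesis
          by blast
      qed simp
      then have "{..<M} \<subseteq> ?U"
        by auto
      moreover have rep: "replicate_mset n c < M" if "c < a" for n c
        using that True M by simp
      have "small ?U TYPE('a)"
        by (intro small_insert small_UN small_lessThan small_nat less.IH rep) simp
      ultimately show ?thesis
        by (rule small_subset[rotated])
    next
      case False
      have "{..<M} = {..<B} \<union> (+) B ` {..<{#a#}}"
        unfolding M using a by (intro lessThan_ordinal_multiset_add) simp
      then have "{..<M} \<subseteq> {..<B} \<union> (+) B ` {..<{#a#}}"
        by simp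
      moreover have "{#a#} < M" "B < M"
        using False M by (auto intro: subset_imp_less_mset)
      ultimately show ?thesis
        by (intro small_subset[OF small_Un[OF less.IH small_image[OF less.IH]]])
    qed
  qed
qed

lemma multiset_rank_least: "multiset_rank M = (LEAST b. \<forall>N<M. multiset_rank N < b)"
  by (subst multiset_rank.simps) (simp add: Ball_def)

lemma multiset_rank_less:
  assumes "N < M"
  shows "multiset_rank N < multiset_rank M"
proof -
  obtain b where "\<forall>a\<in>multiset_rank ` {..<M}. a < b"
    using bdd_above_ordinal[OF small_image[OF small_lessThan_multiset]] by blast
  then have "\<forall>N<M. multiset_rank N < b"
    by auto
  then have "\<forall>N<M. multiset_rank N < multiset_rank M"
    unfolding multiset_rank_least[of M] by (rule LeastI)
  then show ?thesis
    using assms by blast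
qed

lemma multiset_rank_le: "(\<And>N. N < M \<Longrightarrow> multiset_rank N < b) \<Longrightarrow> multiset_rank M \<le> b"
  unfolding multiset_rank_least[of M] by (rule Least_le) blast

lemma strict_mono_multiset_rank: "strict_mono multiset_rank"
  by (rule strict_monoI) (rule multiset_rank_less)

lemma multiset_rank_less_iff [simp]: "multiset_rank M < multiset_rank N \<longleftrightarrow> M < N"
  using strict_mono_less[OF strict_mono_multiset_rank] .

lemma multiset_rank_eq_iff [simp]: "multiset_rank M = multiset_rank N \<longleftrightarrow> M = N"
  using strict_mono_eq[OF strict_mono_multiset_rank] .

text \<open>The range is closed downwards: the first \<open>N\<close> of rank at least
  \<open>b\<close> has rank exactly \<open>b\<close>, as all smaller multisets have rank below
  \<open>b\<close>.\<close>

lemma less_multiset_rankE: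
  assumes "b < multiset_rank M"
  obtains N where "N < M" "multiset_rank N = b"
proof -
  obtain K where K: "K < M" "b \<le> multiset_rank K"
    using assms multiset_rank_le[of M b] by (meson not_le)
  let ?N = "LEAST N. b \<le> multiset_rank N"
  have "b \<le> multiset_rank ?N" "?N \<le> K"
    using K(2) by (rule LeastI, intro Least_le)
  moreover have "multiset_rank ?N \<le> b"
    by (rule multiset_rank_le) (meson not_less_Least not_le)
  ultimately show thesis
    using that K(1) by (meson le_less_trans order.antisym)
qed

lemma multiset_rank_image_lessThan: "multiset_rank ` {..<M} = {..<multiset_rank M}"
  by (auto elim: less_multiset_rankE)

text \<open>Under this hypothesis the natural sum is the ordinal sum: by
  \<open>ordinal_multiset_remainder\<close> the predecessors of \<open>M + N\<close> are those of
  \<open>M\<close> and the \<open>M + N'\<close> with \<open>N' < N\<close>, which matches the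
  recursion of \<open>oadd\<close>.\<close>

lemma multiset_rank_add:
  assumes "\<And>x y. x \<in># M \<Longrightarrow> y \<in># N \<Longrightarrow> y \<le> x"
  shows "multiset_rank (M + N) = oadd (multiset_rank M) (multiset_rank N)"
  using assms
proof (induction N rule: less_induct)
  case (less N)
  have le: "y \<le> x" if "N' < N" "x \<in># M" "y \<in># N'" for x y N'
  proof (rule ccontr)
    assume "\<not> ?thesis"
    then have "z < y" if "z \<in># N" for z
      using less.prems \<open>x \<in># M\<close> that by fastforce
    then have "N < N'"
      using that(3) by (intro ex_gt_imp_less_multiset) auto
    with that(1) show False by simp
  qed
  let ?S = "insert (multiset_rank M) ((\<lambda>b. osuc (oadd (multiset_rank M) b)) ` {..<multiset_rank N})"
  have "?S = insert (multiset_rank M) ((\<lambda>N'. osuc (multiset_rank (M + N'))) ` {..<N})"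
    using less.IH[OF _ le] by (simp flip: multiset_rank_image_lessThan add: image_image)
  moreover have "Sup \<dots> = multiset_rank (M + N)"
  proof (rule cSup_eq_non_empty)
    fix b assume "b \<in> insert (multiset_rank M) ((\<lambda>N'. osuc (multiset_rank (M + N'))) ` {..<N})"
    then show "b \<le> multiset_rank (M + N)"
      by (auto simp: strict_mono_less_eq[OF strict_mono_multiset_rank])
  next
    fix b assume b: "\<And>c. c \<in> insert (multiset_rank M) ((\<lambda>N'. osuc (multiset_rank (M + N'))) ` {..<N}) \<Longrightarrow> c \<le> b"
    show "multiset_rank (M + N) \<le> b"
    proof (rule multiset_rank_le)
      fix K assume K: "K < M + N"
      show "multiset_rank K < b"
      proof (cases "K < M")
        case True
        then show ?thesis
          using b[of "multiset_rank M"] by (auto intro: less_le_trans[OF multiset_rank_less])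
      next
        case False
        then obtain N' where "K = M + N'" "N' < N"
          using ordinal_multiset_remainder[OF less.prems _ K] by (metis not_less)
        then show ?thesis
          using b[of "osuc (multiset_rank K)"] by auto
      qed
    qed
  qed simp
  ultimately show ?case
    by (simp add: oadd.simps[of _ "multiset_rank N"])
qed

lemma multiset_rank_empty [simp]: "multiset_rank {#} = 0"
  by (rule order.antisym) (auto intro: multiset_rank_le)

lemma bdd_above_range_osuc: "bdd_above (range (\<lambda>n. (osuc ^^ n) (0 :: 'a ordinal)))"
  using bdd_above_ordinal[OF small_image[OF small_nat]] by (meson bdd_above.I less_imp_le)

lemma osuc_power_less_omega: "(osuc ^^ n) 0 < omega"
proof -
  have "(osuc ^^ Suc n) 0 \<le> omega"
    unfolding omega_def by (intro cSUP_upper bdd_above_range_osuc) simp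
  then show ?thesis
    by simp
qed

lemma less_omegaE:
  assumes "b < omega"
  obtains n where "b = (osuc ^^ n) 0"
proof -
  obtain n where "b < (osuc ^^ n) 0"
    using assms unfolding omega_def by (subst (asm) less_cSUP_iff) (auto simp: bdd_above_range_osuc)
  then have "\<exists>n. b = (osuc ^^ n) 0"
  proof (induction n)
    case 0
    then show ?case by simp
  next
    case (Suc n)
    then show ?case by (auto simp: le_less)
  qed
  with that show thesis by blast
qed

lemma multiset_rank_replicate:
  assumes "multiset_rank {#c#} = omega_power c"
  shows "multiset_rank (replicate_mset n c) = omult (omega_power c) ((osuc ^^ n) 0)"
proof (induction n)
  case 0
  then show ?case by (simp add: omult_zero)
next
  case (Suc n)
  have "multiset_rank (replicate_mset n c + {#c#}) = oadd (multiset_rank (replicate_mset n c)) (multiset_rank {#c#})"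
    by (rule multiset_rank_add) (auto split: if_splits)
  then show ?case
    by (simp add: Suc assms omult_osuc)
qed

text \<open>This justifies reading \<open>{#b#}\<close> as \<omega>^b. Every nonempty multiset below
  \<open>{#b#}\<close> is bounded by some \<open>replicate_mset n c\<close> with
  \<open>c < b\<close>, and these correspond to the multiples of \<omega>^c in the recursion of
  \<open>omega_power\<close>.\<close>

lemma multiset_rank_single: "multiset_rank {#b#} = omega_power b"
proof (induction b rule: less_induct)
  case (less b)
  note rep = multiset_rank_replicate[OF less.IH]
  have mult: "omult (omega_power c) omega \<le> multiset_rank {#b#}" if "c < b" for c
    unfolding omult.simps[of _ omega]
  proof (rule cSup_least)
    fix d assume "d \<in> (\<lambda>d. oadd (omult (omega_power c) d) (omega_power c)) ` {..<omega}"
    then obtain n where "d = oadd (omult (omega_power c) ((osuc ^^ n) 0)) (omega_power c)"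
      by (auto elim: less_omegaE)
    then have "d = multiset_rank (replicate_mset (Suc n) c)"
      using that by (simp add: rep omult_osuc del: replicate_mset_Suc)
    also have "\<dots> < multiset_rank {#b#}"
      using that by (auto dest: in_replicate_mset[THEN iffD1] simp del: replicate_mset_Suc)
    finally show "d \<le> multiset_rank {#b#}" by simp
  qed (use zero_less_omega in blast)
  show ?case
    unfolding omega_power.simps[of b]
  proof (rule sym, rule cSup_eq_non_empty)
    fix d assume "d \<in> insert 1 ((\<lambda>c. omult (omega_power c) omega) ` {..<b})"
    moreover have "multiset_rank {#} < multiset_rank {#b#}"
      unfolding multiset_rank_less_iff by simp
    ultimately show "d \<le> multiset_rank {#b#}"
      using mult by (auto simp: one_ordinal_def)
  next
    fix u assume u: "\<And>d. d \<in> insert 1 ((\<lambda>c. omult (omega_power c) omega) ` {..<b}) \<Longrightarrow> d \<le> u"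
    show "multiset_rank {#b#} \<le> u"
    proof (rule multiset_rank_le)
      fix N assume N: "N < {#b#}"
      show "multiset_rank N < u"
      proof (cases "N = {#}")
        case True
        then show ?thesis
          using u[of 1] by (simp add: one_ordinal_def)
      next
        case False
        let ?c = "Max_mset N"
        have c: "?c < b"
          using False N by simp
        have "multiset_rank N < multiset_rank (replicate_mset (Suc (size N)) ?c)"
          by (intro multiset_rank_less less_replicate_mset) simp
        also have "\<dots> = oadd (omult (omega_power ?c) ((osuc ^^ size N) 0)) (omega_power ?c)"
          using c by (simp add: rep omult_osuc del: replicate_mset_Suc)
        also have "\<dots> \<le> omult (omega_power ?c) omega"
          by (rule omult_upper[OF osuc_power_less_omega])
        also have "\<dots> \<le> u"
          using c by (intro u) blast
        finally show ?thesis .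
      qed
    qed
  qed simp
qed

section \<open>Ranks of trees\<close>

lemma one_step_ext_iff: "(t, s) \<in> one_step_ext T \<longleftrightarrow> (\<exists>x. t = s @ [x] \<and> s \<in> T \<and> t \<in> T)"
  by (auto simp: one_step_ext_def)

text \<open>A descending chain may start at any node, so the sequence read off along it follows an
  arbitrary prefix \<open>p\<close>.\<close>

lemma wf_one_step_extI:
  assumes "\<And>f :: nat \<Rightarrow> 'b. \<exists>n. \<forall>p. p @ map f [0..<n] \<notin> T"
  shows "wf (one_step_ext T)"
  unfolding wf_iff_no_infinite_down_chain
proof
  assume "\<exists>g. \<forall>i. (g (Suc i), g i) \<in> one_step_ext T"
  then obtain g where g: "\<And>i. (g (Suc i), g i) \<in> one_step_ext T" by blast
  define f where "f i = last (g (Suc i))" for i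
  have f: "g (Suc i) = g i @ [f i]" "g i \<in> T" for i
    using g[of i] by (auto simp: one_step_ext_iff f_def)
  have "g n = g 0 @ map f [0..<n]" for n
    by (induction n) (auto simp: f)
  then have "g 0 @ map f [0..<n] \<in> T" for n
    by (metis f(2))
  then show False
    using assms[of f] by blast
qed

lemma tree_rank_unfold:
  assumes "wf (one_step_ext T)"
  shows "tree_rank T s = (LEAST \<alpha>. \<forall>t. (t, s) \<in> one_step_ext T \<longrightarrow> tree_rank T t < \<alpha>)"
  unfolding tree_rank_def by (subst wfrec[OF assms]) (simp add: cut_apply cong: conj_cong imp_cong)

lemma tree_rank_le:
  assumes "wf (one_step_ext T)" "\<And>t. (t, s) \<in> one_step_ext T \<Longrightarrow> tree_rank T t < M"
  shows "tree_rank T s \<le> M"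
  by (subst tree_rank_unfold[OF assms(1)]) (blast intro: Least_le assms(2))

text \<open>The one-step extensions of a node form a small set, so their ranks have a common strict
  bound and the \<open>LEAST\<close> in the rank is attained.\<close>

lemma tree_rank_less:
  fixes T :: "'b list set"
  assumes wf: "wf (one_step_ext T)" and "small (UNIV :: 'b set) TYPE('a)"
    and t: "(t, s) \<in> one_step_ext T"
  shows "tree_rank T t < (tree_rank T s :: 'a ordinal multiset)"
proof -
  have "small ((\<lambda>x. tree_rank T (s @ [x]) :: 'a ordinal multiset) ` UNIV) TYPE('a)"
    by (rule small_image[OF assms(2)])
  then obtain M :: "'a ordinal multiset" where "\<And>x. tree_rank T (s @ [x]) < M"
    using small_bounded_multiset by blast
  then have "\<forall>t. (t, s) \<in> one_step_ext T \<longrightarrow> tree_rank T t < M"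
    by (auto simp: one_step_ext_iff)
  then have "\<forall>t. (t, s) \<in> one_step_ext T \<longrightarrow> tree_rank T t < (tree_rank T s :: 'a ordinal multiset)"
    by (subst (2) tree_rank_unfold[OF wf]) (rule LeastI)
  with t show ?thesis by blast
qed

text \<open>An order isomorphism onto an initial segment preserves least strict upper bounds. Hence
  ranks can be computed in multisets, where natural sums are plain sums, and translated at the
  end.\<close>

lemma tree_rank_ordinal:
  fixes T :: "'b list set"
  assumes wf: "wf (one_step_ext T)" and small: "small (UNIV :: 'b set) TYPE('a)"
  shows "tree_rank T s = multiset_rank (tree_rank T s :: 'a ordinal multiset)"
  using wf
proof (induction s rule: wf_induct_rule)
  case (less s)
  show ?case
  proof (rule order.antisym)
    show "tree_rank T s \<le> multiset_rank (tree_rank T s :: 'a ordinal multiset)"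
      by (rule tree_rank_le[OF wf]) (simp add: less tree_rank_less[OF wf small])
    show "multiset_rank (tree_rank T s :: 'a ordinal multiset) \<le> tree_rank T s"
    proof (rule ccontr)
      assume "\<not> ?thesis"
      then obtain N where N: "N < tree_rank T s" "multiset_rank N = (tree_rank T s :: 'a ordinal)"
        by (auto simp: not_le elim: less_multiset_rankE)
      then obtain t where t: "(t, s) \<in> one_step_ext T" "N \<le> tree_rank T t"
        using tree_rank_le[OF wf, of s N] by (meson not_le)
      then have "multiset_rank N \<le> (tree_rank T t :: 'a ordinal)"
        by (simp add: less strict_mono_less_eq[OF strict_mono_multiset_rank])
      then have "\<forall>u. (u, s) \<in> one_step_ext T \<longrightarrow> tree_rank T u < (tree_rank T s :: 'a ordinal) \<Longrightarrow> False"
        using t N by auto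
      moreover have "\<forall>u. (u, s) \<in> one_step_ext T \<longrightarrow> tree_rank T u < (tree_rank T s :: 'a ordinal)"
      proof (subst (2) tree_rank_unfold[OF wf], rule LeastI)
        show "\<forall>u. (u, s) \<in> one_step_ext T \<longrightarrow>
            tree_rank T u < multiset_rank (tree_rank T s :: 'a ordinal multiset)"
          by (simp add: less tree_rank_less[OF wf small])
      qed
      ultimately show False by blast
    qed
  qed
qed

lemma one_step_ext_Cons:
  "(t, x # s) \<in> one_step_ext T \<longleftrightarrow> (\<exists>u. t = x # u \<and> (u, s) \<in> one_step_ext {s. x # s \<in> T})"
  by (auto simp: one_step_ext_iff)

lemma wf_one_step_ext_Cons:
  assumes "wf (one_step_ext T)"
  shows "wf (one_step_ext {s. x # s \<in> T})"
  by (rule wf_subset[OF wf_inv_image[OF assms, of "(#) x"]]) (auto simp: one_step_ext_iff)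

text \<open>For bad sequences and antichains the subtree at \<open>x\<close> is the tree of a
  residual, so ranks become recursions on residuals.\<close>

lemma tree_rank_Cons:
  assumes "wf (one_step_ext T)"
  shows "tree_rank T (x # s) = (tree_rank {s. x # s \<in> T} s :: 'o::wellorder)"
  using wf_one_step_ext_Cons[OF assms, of x]
proof (induction s rule: wf_induct_rule)
  case (less s)
  have "(\<forall>t. (t, x # s) \<in> one_step_ext T \<longrightarrow> tree_rank T t < \<alpha>) \<longleftrightarrow>
      (\<forall>u. (u, s) \<in> one_step_ext {s. x # s \<in> T} \<longrightarrow> tree_rank {s. x # s \<in> T} u < \<alpha>)" for \<alpha> :: 'o
    unfolding one_step_ext_Cons using less by auto
  then show ?case
    by (simp only: tree_rank_unfold[OF assms, of "x # s"]
        tree_rank_unfold[OF wf_one_step_ext_Cons[OF assms], of x s])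
qed

lemma tree_rank_Nil_le:
  assumes "wf (one_step_ext T)" "\<And>x. [x] \<in> T \<Longrightarrow> tree_rank {s. x # s \<in> T} [] < M"
  shows "tree_rank T [] \<le> M"
  by (rule tree_rank_le[OF assms(1)])
    (auto simp: one_step_ext_iff tree_rank_Cons[OF assms(1)] assms(2))

lemma tree_rank_Nil_less:
  fixes T :: "'b list set"
  assumes "wf (one_step_ext T)" "small (UNIV :: 'b set) TYPE('a)" "[] \<in> T" "[x] \<in> T"
  shows "tree_rank {s. x # s \<in> T} [] < (tree_rank T [] :: 'a ordinal multiset)"
  using tree_rank_less[OF assms(1,2), of "[x]" "[]"] assms
  by (auto simp: one_step_ext_iff tree_rank_Cons[OF assms(1)])

section \<open>The multiset ordering\<close>

lemma multiset_le_add_left [simp]: "multiset_le le (p + q) (p + q') \<longleftrightarrow> multiset_le le q q'"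
proof -
  have "(p + q) \<inter># (p + q') = p + (q \<inter># q')"
    by (rule multiset_eqI) (simp add: min_add_distrib_left)
  then show ?thesis
    by (simp add: multiset_le_def)
qed

lemma incomparable_multiset_add_left [simp]:
  "incomparable (multiset_le le) (p + q) (p + q') \<longleftrightarrow> incomparable (multiset_le le) q q'"
  by (simp add: incomparable_def)

lemma incomparable_sym: "incomparable R x y \<longleftrightarrow> incomparable R y x"
  by (auto simp: incomparable_def)

lemma multiset_le_refl [simp]: "multiset_le le m m"
  by (simp add: multiset_le_def)

text \<open>The surplus of \<open>x\<close> survives the cancellation of the common part, and
  nothing in \<open>m'\<close> dominates it.\<close>

lemma not_multiset_leI:
  assumes "count m' x < count m x" "\<And>y. y \<in># m' \<Longrightarrow> le x y \<Longrightarrow> y = x"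
  shows "\<not> multiset_le le m m'"
proof
  assume "multiset_le le m m'"
  moreover have "m \<noteq> m'" "x \<in># m - m \<inter># m'"
    using assms(1) by (auto simp: in_diff_count)
  ultimately obtain y where "y \<in># m' - m \<inter># m'" "le x y" "x \<noteq> y"
    unfolding multiset_le_def by blast
  with assms(2)[of y] show False
    by (auto dest: in_diffD)
qed

lemma antichain_seqs_Cons:
  "y \<in> Y \<Longrightarrow> {s. y # s \<in> antichain_seqs Y R} = antichain_seqs (incomparable_part Y R y) R"
  by (auto simp: antichain_seqs_def incomparable_part_def incomparable_sym[of R y])

lemma finite_submultisets: "finite {p. p \<subseteq># m}"
proof (induction m)
  case (add x m)
  have "p \<in> {p. p \<subseteq># m} \<union> add_mset x ` {p. p \<subseteq># m}" if "p \<subseteq># add_mset x m" for p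
  proof (cases "x \<in># p")
    case True
    then obtain p' where "p = add_mset x p'"
      by (metis multi_member_split)
    with that show ?thesis by auto
  next
    case False
    then have "p - {#x#} = p"
      by (rule diff_single_trivial)
    with that have "p \<subseteq># m"
      by (metis add_mset_add_single subset_eq_diff_conv)
    then show ?thesis by blast
  qed
  then have "{p. p \<subseteq># add_mset x m} \<subseteq> {p. p \<subseteq># m} \<union> add_mset x ` {p. p \<subseteq># m}"
    by blast
  then show ?case
    by (rule finite_subset) (use add in simp)
qed simp

section \<open>Ranks of trees of bad sequences\<close>

locale well_partial_order =
  fixes U :: "'a set" and le :: "'a \<Rightarrow> 'a \<Rightarrow> bool"
  assumes wpo: "wpo_on U le"
begin

lemma le_refl: "x \<in> U \<Longrightarrow> le x x"
  using wpo by (auto simp: wpo_on_def reflp_on_def)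

lemma le_antisym: "le x y \<Longrightarrow> le y x \<Longrightarrow> x \<in> U \<Longrightarrow> y \<in> U \<Longrightarrow> x = y"
  using wpo by (auto simp: wpo_on_def antisymp_on_def)

lemma le_trans: "le x y \<Longrightarrow> le y z \<Longrightarrow> x \<in> U \<Longrightarrow> y \<in> U \<Longrightarrow> z \<in> U \<Longrightarrow> le x z"
  using wpo unfolding wpo_on_def by (meson transp_onD)

lemma ex_increasing_pair:
  fixes f :: "nat \<Rightarrow> 'a"
  assumes "\<And>i. f i \<in> U"
  shows "\<exists>i j. i < j \<and> le (f i) (f j)"
  using wpo assms by (auto simp: wpo_on_def image_subset_iff)

abbreviation not_above :: "'a set \<Rightarrow> 'a \<Rightarrow> 'a set" where
  "not_above E x \<equiv> not_above_part E le [x]"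

lemma not_above_part_iff: "y \<in> not_above_part E le p \<longleftrightarrow> y \<in> E \<and> (\<forall>x\<in>set p. \<not> le x y)"
  by (simp add: not_above_part_def)

lemma not_above_part_subset: "not_above_part E le p \<subseteq> E"
  by (auto simp: not_above_part_iff)

text \<open>\<open>Q p x\<close> restricts an entry \<open>x\<close> in terms of the entries
  \<open>p\<close> before it. The constantly true condition gives the maximal order type and
  \<open>has_friend X\<close> the friendly rank, so monotonicity and subadditivity are proved for
  both at once.\<close>

definition bad_seqs_such_that :: "('a list \<Rightarrow> 'a \<Rightarrow> bool) \<Rightarrow> 'a set \<Rightarrow> 'a list set" where
  "bad_seqs_such_that Q E = {s \<in> bad_seqs E le. \<forall>p x q. s = p @ x # q \<longrightarrow> Q p x}"

definition bad_rank :: "('a list \<Rightarrow> 'a \<Rightarrow> bool) \<Rightarrow> 'a set \<Rightarrow> 'a ordinal multiset" where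
  "bad_rank Q E = tree_rank (bad_seqs_such_that Q E) []"

lemma wf_bad_seqs_such_that:
  assumes "E \<subseteq> U"
  shows "wf (one_step_ext (bad_seqs_such_that Q E))"
proof (rule wf_one_step_extI, rule ccontr)
  fix f :: "nat \<Rightarrow> 'a"
  assume "\<nexists>n. \<forall>p. p @ map f [0..<n] \<notin> bad_seqs_such_that Q E"
  then have bad: "map f [0..<n] \<in> bad_seqs E le" for n
    by (force simp: bad_seqs_such_that_def bad_seqs_def sorted_wrt_append)
  have "f i \<in> U" for i
    using bad[of "Suc i"] assms by (auto simp: bad_seqs_def)
  then obtain i j where "i < j" "le (f i) (f j)"
    using ex_increasing_pair by blast
  with bad[of "Suc j"] show False
    by (auto simp: bad_seqs_def sorted_wrt_iff_nth_less simp del: upt_Suc dest!: spec[of _ i] spec[of _ j])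
qed

lemma bad_seqs_such_that_Cons:
  assumes "x \<in> E" "Q [] x"
  shows "{s. x # s \<in> bad_seqs_such_that Q E} = bad_seqs_such_that (\<lambda>p. Q (x # p)) (not_above E x)"
proof -
  have "(\<forall>p y q. x # s = p @ y # q \<longrightarrow> Q p y) \<longleftrightarrow> (\<forall>p y q. s = p @ y # q \<longrightarrow> Q (x # p) y)" for s
    using assms(2) by (auto simp: Cons_eq_append_conv)
  then show ?thesis
    using assms(1) by (auto simp: bad_seqs_such_that_def bad_seqs_def not_above_part_iff)
qed

lemma singleton_in_bad_seqs_such_that: "[x] \<in> bad_seqs_such_that Q E \<longleftrightarrow> x \<in> E \<and> Q [] x"
  by (auto simp: bad_seqs_such_that_def bad_seqs_def Cons_eq_append_conv)

lemma bad_rank_less: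
  assumes "E \<subseteq> U" "x \<in> E" "Q [] x"
  shows "bad_rank (\<lambda>p. Q (x # p)) (not_above E x) < bad_rank Q E"
proof -
  have "[] \<in> bad_seqs_such_that Q E"
    by (simp add: bad_seqs_such_that_def bad_seqs_def)
  then show ?thesis
    using tree_rank_Nil_less[OF wf_bad_seqs_such_that[OF assms(1)] small_UNIV, of Q x] assms
    by (simp add: singleton_in_bad_seqs_such_that bad_seqs_such_that_Cons bad_rank_def)
qed

lemma bad_rank_le:
  assumes "E \<subseteq> U" "\<And>x. x \<in> E \<Longrightarrow> Q [] x \<Longrightarrow> bad_rank (\<lambda>p. Q (x # p)) (not_above E x) < M"
  shows "bad_rank Q E \<le> M"
  unfolding bad_rank_def
  by (rule tree_rank_Nil_le[OF wf_bad_seqs_such_that[OF assms(1)]])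
    (use assms(2) in \<open>auto simp: singleton_in_bad_seqs_such_that bad_seqs_such_that_Cons bad_rank_def\<close>)

definition otype :: "'a set \<Rightarrow> 'a ordinal multiset" where
  "otype = bad_rank (\<lambda>_ _. True)"

lemma otype_eq: "otype E = tree_rank (bad_seqs E le) []"
  by (simp add: otype_def bad_rank_def bad_seqs_such_that_def)

lemma otype_less: "E \<subseteq> U \<Longrightarrow> x \<in> E \<Longrightarrow> otype (not_above E x) < otype E"
  using bad_rank_less[of E x "\<lambda>_ _. True"] by (simp add: otype_def)

lemma otype_le: "E \<subseteq> U \<Longrightarrow> (\<And>x. x \<in> E \<Longrightarrow> otype (not_above E x) < M) \<Longrightarrow> otype E \<le> M"
  using bad_rank_le[of E "\<lambda>_ _. True" M] by (simp add: otype_def)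

text \<open>Passing to a residual strictly lowers \<open>otype\<close>, so induction on the type
  becomes induction on residuals.\<close>

lemma subset_induct [consumes 1, case_names step]:
  assumes "E \<subseteq> U"
    and "\<And>E. E \<subseteq> U \<Longrightarrow> (\<And>x. x \<in> E \<Longrightarrow> P (not_above E x)) \<Longrightarrow> P E"
  shows "P E"
  using assms(1)
proof (induction "otype E" arbitrary: E rule: less_induct)
  case less
  show ?case
    by (rule assms(2)[OF less.prems])
      (meson less otype_less not_above_part_subset subset_trans)
qed

lemma bad_rank_mono:
  assumes "E \<subseteq> E'" "E' \<subseteq> U"
    and "\<And>p x. set p \<subseteq> E \<Longrightarrow> x \<in> not_above_part E le p \<Longrightarrow> Q p x \<Longrightarrow> Q' p x"
  shows "bad_rank Q E \<le> bad_rank Q' E'"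
proof -
  have "E \<subseteq> U"
    using assms by blast
  then show ?thesis
    using assms
  proof (induction E arbitrary: Q Q' E' rule: subset_induct)
    case (step E)
    show ?case
    proof (rule bad_rank_le[OF step.hyps(1)])
      fix x assume x: "x \<in> E" "Q [] x"
      have "bad_rank (\<lambda>p. Q (x # p)) (not_above E x) \<le> bad_rank (\<lambda>p. Q' (x # p)) (not_above E' x)"
      proof (rule step.IH[OF x(1)])
        fix p y
        assume "set p \<subseteq> not_above E x" "y \<in> not_above_part (not_above E x) le p" "Q (x # p) y"
        then show "Q' (x # p) y"
          using x by (intro step.prems(3)) (auto simp: not_above_part_iff)
      qed (use step.prems in \<open>auto simp: not_above_part_iff\<close>)
      also have "\<dots> < bad_rank Q' E'"
        using x step.prems(3)[of "[]" x] step.prems(1,2)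
        by (intro bad_rank_less) (auto simp: not_above_part_iff)
      finally show "bad_rank (\<lambda>p. Q (x # p)) (not_above E x) < bad_rank Q' E'" .
    qed
  qed
qed

text \<open>A move lies in \<open>A\<close> or \<open>B\<close> and strictly lowers the rank of that
  part. The rank of the other part does not grow, because a longer history makes \<open>Q\<close>
  harder to satisfy.\<close>

lemma bad_rank_Un:
  assumes "A \<subseteq> U" "B \<subseteq> U" and "\<And>p q x. set p \<subseteq> set q \<Longrightarrow> Q q x \<Longrightarrow> Q p x"
  shows "bad_rank Q (A \<union> B) \<le> bad_rank Q A + bad_rank Q B"
proof -
  define E where "E = A \<union> B"
  then have "E \<subseteq> U"
    using assms by blast
  then have "bad_rank Q E \<le> bad_rank Q A + bad_rank Q B"
    using E_def assms
  proof (induction E arbitrary: A B Q rule: subset_induct)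
    case (step E)
    show ?case
    proof (rule bad_rank_le[OF step.hyps(1)])
      fix x assume x: "x \<in> E" "Q [] x"
      let ?Q = "\<lambda>p. Q (x # p)"
      have eq: "not_above E x = not_above A x \<union> not_above B x"
        using step.prems(1) by (auto simp: not_above_part_iff)
      have "bad_rank ?Q (not_above E x) \<le> bad_rank ?Q (not_above A x) + bad_rank ?Q (not_above B x)"
      proof (rule step.IH[OF x(1) eq])
        fix p q y assume "set p \<subseteq> set q" "?Q q y"
        then show "?Q p y"
          by (intro step.prems(4)[of "x # p" "x # q"]) auto
      qed (use step.prems in \<open>auto simp: not_above_part_iff\<close>)
      also have "\<dots> < bad_rank Q A + bad_rank Q B"
      proof -
        have mono: "bad_rank ?Q (not_above C x) \<le> bad_rank Q C" if "C \<subseteq> U" for C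
          by (rule bad_rank_mono[OF not_above_part_subset that]) (rule step.prems(4), auto)
        consider "x \<in> A" | "x \<in> B"
          using x step.prems(1) by blast
        then show ?thesis
        proof cases
          case 1
          show ?thesis
            by (rule add_less_le_mono[OF bad_rank_less[where Q = Q, OF step.prems(2) 1 x(2)] mono[OF step.prems(3)]])
        next
          case 2
          show ?thesis
            by (rule add_le_less_mono[OF mono[OF step.prems(2)] bad_rank_less[where Q = Q, OF step.prems(3) 2 x(2)]])
        qed
      qed
      finally show "bad_rank ?Q (not_above E x) < bad_rank Q A + bad_rank Q B" .
    qed
  qed
  then show ?thesis
    by (simp add: E_def)
qed

lemma otype_mono: "A \<subseteq> B \<Longrightarrow> B \<subseteq> U \<Longrightarrow> otype A \<le> otype B"
  unfolding otype_def by (rule bad_rank_mono)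

lemma otype_Un: "A \<subseteq> U \<Longrightarrow> B \<subseteq> U \<Longrightarrow> otype (A \<union> B) \<le> otype A + otype B"
  unfolding otype_def by (rule bad_rank_Un)

text \<open>While the type exceeds \<open>M\<close>, some residual still has type at least
  \<open>M\<close>; the descent must end at exactly \<open>M\<close>.\<close>

lemma ex_subset_type_eq:
  assumes "E \<subseteq> U" "M \<le> otype E"
  obtains T where "T \<subseteq> E" "otype T = M"
proof -
  have "\<exists>T\<subseteq>E. otype T = M"
    using assms
  proof (induction E rule: subset_induct)
    case (step E)
    show ?case
    proof (cases "otype E = M")
      case False
      then have "M < otype E"
        using step.prems by simp
      then obtain x where "x \<in> E" "M \<le> otype (not_above E x)"
        using otype_le[OF step.hyps(1), of M] by (meson not_le)
      with step.IH show ?thesis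
        using not_above_part_subset by (metis subset_trans)
    qed blast
  qed
  with that show thesis by blast
qed

section \<open>Friends and the friendly rank\<close>

definition has_friend :: "'a set \<Rightarrow> 'a list \<Rightarrow> 'a \<Rightarrow> bool" where
  "has_friend X p x \<longleftrightarrow> incomparable_part (not_above_part X le p) le x \<noteq> {}"

lemma has_friend_iff:
  "has_friend X p x \<longleftrightarrow> (\<exists>y\<in>X. incomparable le y x \<and> (\<forall>z\<in>set p. \<not> le z y))"
  by (auto simp: has_friend_def incomparable_part_def not_above_part_iff)

lemma has_friend_not_above: "has_friend (not_above X x) = (\<lambda>p. has_friend X (x # p))"
  by (auto simp: fun_eq_iff has_friend_iff not_above_part_iff)

text \<open>Sequences run in \<open>E\<close> but friends are sought in \<open>X\<close>, so that
  \<open>E\<close> can be cut down without losing friends.\<close>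

definition friendly_rank :: "'a set \<Rightarrow> 'a set \<Rightarrow> 'a ordinal multiset" where
  "friendly_rank X = bad_rank (has_friend X)"

lemma friendly_rank_less:
  "E \<subseteq> U \<Longrightarrow> x \<in> E \<Longrightarrow> has_friend X [] x \<Longrightarrow>
    friendly_rank (not_above X x) (not_above E x) < friendly_rank X E"
  unfolding friendly_rank_def has_friend_not_above by (rule bad_rank_less)

lemma friendly_rank_le:
  "E \<subseteq> U \<Longrightarrow>
    (\<And>x. x \<in> E \<Longrightarrow> has_friend X [] x \<Longrightarrow> friendly_rank (not_above X x) (not_above E x) < M) \<Longrightarrow>
    friendly_rank X E \<le> M"
  unfolding friendly_rank_def has_friend_not_above by (rule bad_rank_le)

lemma has_friend_mono: "X \<subseteq> X' \<Longrightarrow> set p \<subseteq> set q \<Longrightarrow> has_friend X q x \<Longrightarrow> has_friend X' p x"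
  unfolding has_friend_iff by blast

lemma friendly_rank_mono:
  "X \<subseteq> X' \<Longrightarrow> E \<subseteq> E' \<Longrightarrow> E' \<subseteq> U \<Longrightarrow> friendly_rank X E \<le> friendly_rank X' E'"
  unfolding friendly_rank_def by (rule bad_rank_mono) (auto intro: has_friend_mono)

lemma friendly_rank_Un:
  "A \<subseteq> U \<Longrightarrow> B \<subseteq> U \<Longrightarrow> friendly_rank X (A \<union> B) \<le> friendly_rank X A + friendly_rank X B"
  unfolding friendly_rank_def by (rule bad_rank_Un) (auto intro: has_friend_mono)

lemma friendly_rank_le_type: "E \<subseteq> U \<Longrightarrow> friendly_rank X E \<le> otype E"
  unfolding friendly_rank_def otype_def by (rule bad_rank_mono) auto

lemma friendly_rank_pos: "E \<subseteq> U \<Longrightarrow> x \<in> E \<Longrightarrow> has_friend X [] x \<Longrightarrow> {#0#} \<le> friendly_rank X E"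
  using friendly_rank_less[of E x X] add_zero_mset_le[of "{#}" "friendly_rank X E"]
  by (simp add: le_less_trans[OF less_eq_multiset_empty_left])

text \<open>All bad sequences in \<open>V\<close> are then friendly: the friend of \<open>x\<close> survives in every residual by
  elements of \<open>V\<close> that contains \<open>x\<close>.\<close>

definition strongly_safe :: "'a set \<Rightarrow> 'a set \<Rightarrow> bool" where
  "strongly_safe X V \<longleftrightarrow> V \<subseteq> X \<and>
    (\<forall>x\<in>V. \<exists>y\<in>X. incomparable le y x \<and> (\<forall>z\<in>V. le z y \<longrightarrow> le z x))"

lemma strongly_safe_subset: "strongly_safe X V \<Longrightarrow> W \<subseteq> V \<Longrightarrow> strongly_safe X W"
  unfolding strongly_safe_def by (meson subset_iff)

lemma strongly_safe_has_friend:
  assumes "strongly_safe X V" "set p \<subseteq> V" "x \<in> not_above_part V le p"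
  shows "has_friend X p x"
  using assms unfolding strongly_safe_def has_friend_iff not_above_part_iff by (meson subset_iff)

lemma friendly_rank_strongly_safe:
  assumes "strongly_safe X V" "V \<subseteq> U"
  shows "friendly_rank X V = otype V"
proof (rule order.antisym)
  show "friendly_rank X V \<le> otype V"
    by (rule friendly_rank_le_type[OF assms(2)])
  show "otype V \<le> friendly_rank X V"
    unfolding friendly_rank_def otype_def
    by (rule bad_rank_mono[OF order_refl assms(2)]) (rule strongly_safe_has_friend[OF assms(1)])
qed

text \<open>The values are normal forms, and \<open>M\<close> is not tied to \<open>otype T\<close>.
  Maximality is obtained later from
  \<open>M \<le> friendly_rank X T \<le> otype T \<le> M\<close>.\<close>

definition safe_linearisation ::
    "'a set \<Rightarrow> 'a set \<Rightarrow> ('a \<Rightarrow> 'a ordinal multiset) \<Rightarrow> 'a ordinal multiset \<Rightarrow> bool" where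
  "safe_linearisation X T l M \<longleftrightarrow> T \<subseteq> X \<and> bij_betw l T {..<M} \<and>
    (\<forall>x\<in>T. \<forall>y\<in>T. le x y \<and> x \<noteq> y \<longrightarrow> l x < l y) \<and>
    (\<forall>p x. set p \<subseteq> T \<and> x \<in> T \<and> (\<forall>y\<in>set p. l x < l y) \<longrightarrow> has_friend X p x)"

text \<open>Playing elements with decreasing \<open>l\<close> gives friendly bad sequences only, and
  the tree of decreasing sequences in \<open>{..<M}\<close> has rank \<open>M\<close>.\<close>

lemma safe_linearisation_le_friendly_rank:
  assumes lin: "safe_linearisation X T l M" and X: "X \<subseteq> U"
  shows "M \<le> friendly_rank X T"
proof -
  have T: "T \<subseteq> X" and bij: "bij_betw l T {..<M}"
    and mono: "\<And>x y. x \<in> T \<Longrightarrow> y \<in> T \<Longrightarrow> le x y \<Longrightarrow> l x \<le> l y"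
    and friend: "\<And>p x. set p \<subseteq> T \<Longrightarrow> x \<in> T \<Longrightarrow> (\<And>y. y \<in> set p \<Longrightarrow> l x < l y) \<Longrightarrow> has_friend X p x"
    using lin unfolding safe_linearisation_def by (auto simp: le_less)
  \<comment> \<open>Here \<open>p\<close> lists elements already played, all at positions
    \<open>N\<close> or later.\<close>
  have "N \<le> friendly_rank (not_above_part X le p) {x \<in> T. l x < N}"
    if "N \<le> M" "set p \<subseteq> T" "\<And>y. y \<in> set p \<Longrightarrow> N \<le> l y" for N p
    using that
  proof (induction N arbitrary: p rule: less_induct)
    case (less N)
    show ?case
    proof (rule ccontr)
      define K where "K = friendly_rank (not_above_part X le p) {x \<in> T. l x < N}"
      assume "\<not> ?thesis"
      then have K: "K < N"
        by (simp add: K_def)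
      \<comment> \<open>The element at position \<open>K\<close> is a legal move after which the
        rank is at least \<open>K\<close>, so the rank before it exceeds \<open>K\<close>.\<close>
      then have "K \<in> l ` T"
        using bij less.prems(1) by (auto simp: bij_betw_def)
      then obtain x where x: "x \<in> T" "l x = K"
        by blast
      have "K \<le> friendly_rank (not_above_part X le (x # p)) {y \<in> T. l y < K}"
        using less.prems K x by (intro less.IH) (auto intro: less_imp_le order.strict_trans2)
      also have "\<dots> \<le> friendly_rank (not_above (not_above_part X le p) x) (not_above {x \<in> T. l x < N} x)"
        using T X K x mono by (intro friendly_rank_mono) (force simp: not_above_part_iff)+
      also have "\<dots> < friendly_rank (not_above_part X le p) {x \<in> T. l x < N}"
      proof (rule friendly_rank_less)
        have "has_friend X p x"
          using friend[OF less.prems(2) x(1)] less.prems(3) K x(2) by (blast intro: order.strict_trans2)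
        then show "has_friend (not_above_part X le p) [] x"
          by (simp add: has_friend_def not_above_part_def)
      qed (use T X x K in auto)
      finally show False
        by (simp add: K_def)
    qed
  qed
  from this[of M "[]"] have "M \<le> friendly_rank X {x \<in> T. l x < M}"
    by (simp add: not_above_part_def)
  also have "\<dots> \<le> friendly_rank X T"
    using T X by (intro friendly_rank_mono) auto
  finally show ?thesis .
qed

lemma safe_linearisation_mono:
  "safe_linearisation X T l M \<Longrightarrow> X \<subseteq> X' \<Longrightarrow> safe_linearisation X' T l M"
  unfolding safe_linearisation_def by (blast intro: has_friend_mono[OF _ order_refl])

section \<open>Linearisations\<close>

text \<open>A linear extension has type at most \<open>otype T\<close>, because its descending
  sequences are bad. The isomorphism \<open>h\<close> is the rank function of
  \<open>lt\<close>.\<close>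

lemma ex_order_type:
  assumes T: "T \<subseteq> U"
    and trans: "\<And>x y z. x \<in> T \<Longrightarrow> y \<in> T \<Longrightarrow> z \<in> T \<Longrightarrow> lt x y \<Longrightarrow> lt y z \<Longrightarrow> lt x z"
    and irrefl: "\<And>x. x \<in> T \<Longrightarrow> \<not> lt x x"
    and total: "\<And>x y. x \<in> T \<Longrightarrow> y \<in> T \<Longrightarrow> x \<noteq> y \<Longrightarrow> lt x y \<or> lt y x"
    and ext: "\<And>x y. x \<in> T \<Longrightarrow> y \<in> T \<Longrightarrow> le x y \<Longrightarrow> x \<noteq> y \<Longrightarrow> lt x y"
  obtains h and H :: "'a ordinal multiset" where "bij_betw h T {..<H}" "H \<le> otype T"
    "\<And>x y. x \<in> T \<Longrightarrow> y \<in> T \<Longrightarrow> lt x y \<Longrightarrow> h x < h y"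
proof -
  have not_le: "\<not> le y z" if yz: "y \<in> T" "z \<in> T" "lt z y" for y z
  proof
    assume "le y z"
    then have "y = z \<or> lt y z"
      using ext yz(1,2) by blast
    then have "lt y y"
      using yz trans[of y z y] by blast
    then show False
      using irrefl yz(1) by blast
  qed
  define R where "R = {(x, y). x \<in> T \<and> y \<in> T \<and> lt x y}"
  have wf: "wf R"
    unfolding wf_iff_no_infinite_down_chain
  proof
    assume "\<exists>g. \<forall>i. (g (Suc i), g i) \<in> R"
    then obtain g where g: "\<And>i. (g (Suc i), g i) \<in> R" by blast
    have desc: "(g (Suc (i + k)), g i) \<in> R" for i k
    proof (induction k)
      case (Suc k)
      then show ?case
        using g[of "Suc (i + k)"] by (auto simp: R_def intro: trans)
    qed (use g in simp)
    have gT: "g i \<in> T" for i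
      using g[of i] by (auto simp: R_def)
    then obtain i j where "i < j" "le (g i) (g j)"
      using ex_increasing_pair[of g] T by blast
    moreover from \<open>i < j\<close> have "lt (g j) (g i)"
      using desc[of i "j - Suc i"] by (auto simp: R_def)
    ultimately show False
      using not_le[OF gT gT] by blast
  qed
  define h :: "'a \<Rightarrow> 'a ordinal multiset"
    where "h = wfrec R (\<lambda>h x. LEAST N. \<forall>y. (y, x) \<in> R \<longrightarrow> h y < N)"
  have h: "h x = (LEAST N. \<forall>y. (y, x) \<in> R \<longrightarrow> h y < N)" for x
    unfolding h_def by (subst wfrec[OF wf]) (simp add: cut_apply cong: conj_cong imp_cong)
  \<comment> \<open>\<open>D\<close> is what is left of \<open>T\<close> during a descent: moving to
    \<open>y\<close> replaces it by the residual of \<open>y\<close>, which still contains all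
    predecessors of \<open>y\<close>.\<close>
  have bound: "h x \<le> otype D" if "D \<subseteq> T" "{y. (y, x) \<in> R} \<subseteq> D" for x D
    using wf that
  proof (induction x arbitrary: D rule: wf_induct_rule)
    case (less x)
    have "h y < otype D" if y: "(y, x) \<in> R" for y
    proof -
      have yD: "y \<in> D"
        using less.prems(2) y by blast
      have "h y \<le> otype (not_above D y)"
      proof (rule less.IH[OF y])
        show "{z. (z, y) \<in> R} \<subseteq> not_above D y"
        proof
          fix z assume "z \<in> {z. (z, y) \<in> R}"
          then have z: "z \<in> T" "y \<in> T" "x \<in> T" "lt z y" "(z, x) \<in> R"
            using y by (auto simp: R_def intro: trans)
          then have "\<not> le y z"
            using not_le by blast
          with z less.prems(2) show "z \<in> not_above D y"
            by (auto simp: not_above_part_iff)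
        qed
      qed (use less.prems(1) not_above_part_subset in blast)
      also have "\<dots> < otype D"
        using less.prems(1) T yD by (intro otype_less) auto
      finally show ?thesis .
    qed
    then show ?case
      by (subst h) (blast intro: Least_le)
  qed
  have h_less: "h y < h x" if "(y, x) \<in> R" for x y
  proof -
    have "h y < otype T" if "(y, x) \<in> R" for y
    proof -
      have "h y \<le> otype (not_above T y)"
      proof (rule bound)
        show "{z. (z, y) \<in> R} \<subseteq> not_above T y"
          using not_le by (auto simp: R_def not_above_part_iff)
      qed (rule not_above_part_subset)
      also have "\<dots> < otype T"
        using that T by (intro otype_less) (auto simp: R_def)
      finally show ?thesis .
    qed
    then have "\<forall>y. (y, x) \<in> R \<longrightarrow> h y < otype T"
      by blast
    from LeastI[of "\<lambda>N. \<forall>y. (y, x) \<in> R \<longrightarrow> h y < N", OF this] show ?thesis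
      unfolding h[of x, symmetric] using that by blast
  qed
  have h_less_type: "h x < otype T" if "x \<in> T" for x
  proof -
    have "h x \<le> otype (not_above T x)"
    proof (rule bound)
      show "{z. (z, x) \<in> R} \<subseteq> not_above T x"
        using not_le by (auto simp: R_def not_above_part_iff)
    qed (rule not_above_part_subset)
    also have "\<dots> < otype T"
      using that T by (intro otype_less) auto
    finally show ?thesis .
  qed
  have surj: "\<exists>y\<in>T. h y = K" if "x \<in> T" "K \<le> h x" for x K
    using wf that
  proof (induction x rule: wf_induct_rule)
    case (less x)
    show ?case
    proof (cases "K = h x")
      case False
      then have "K < h x"
        using less.prems by simp
      then have "\<not> (\<forall>y. (y, x) \<in> R \<longrightarrow> h y < K)"
        unfolding h[of x] by (rule not_less_Least)
      then obtain y where "(y, x) \<in> R" "K \<le> h y"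
        by (auto simp: not_less)
      then show ?thesis
        using less.IH by (auto simp: R_def)
    qed (use less.prems in blast)
  qed
  define H where "H = (LEAST N. \<forall>x\<in>T. h x < N)"
  have "\<forall>x\<in>T. h x < otype T"
    using h_less_type by blast
  then have H: "\<forall>x\<in>T. h x < H" "H \<le> otype T"
    unfolding H_def by (rule LeastI, rule Least_le)
  show thesis
  proof (rule that[OF _ H(2)])
    have "inj_on h T"
    proof (rule inj_onI, rule ccontr)
      fix x y assume xy: "x \<in> T" "y \<in> T" "h x = h y" "x \<noteq> y"
      then have "(x, y) \<in> R \<or> (y, x) \<in> R"
        using total by (auto simp: R_def)
      with xy(3) show False
        using h_less by fastforce
    qed
    moreover have "h ` T = {..<H}"
    proof (intro equalityI subsetI)
      fix K assume "K \<in> {..<H}"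
      then have "\<not> (\<forall>x\<in>T. h x < K)"
        unfolding H_def lessThan_iff by (rule not_less_Least)
      then obtain x where "x \<in> T" "K \<le> h x"
        by (auto simp: not_less)
      then show "K \<in> h ` T"
        using surj by blast
    qed (use H(1) in auto)
    ultimately show "bij_betw h T {..<H}"
      by (simp add: bij_betw_def)
    show "h x < h y" if "x \<in> T" "y \<in> T" "lt x y" for x y
      using that by (intro h_less) (simp add: R_def)
  qed
qed

lemma safe_linearisationD:
  assumes "safe_linearisation X T l M"
  shows "T \<subseteq> X" "bij_betw l T {..<M}"
    "x \<in> T \<Longrightarrow> y \<in> T \<Longrightarrow> le x y \<Longrightarrow> x \<noteq> y \<Longrightarrow> l x < l y"
    "set p \<subseteq> T \<Longrightarrow> x \<in> T \<Longrightarrow> (\<And>y. y \<in> set p \<Longrightarrow> l x < l y) \<Longrightarrow> has_friend X p x"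
  using assms unfolding safe_linearisation_def by auto

lemma safe_linearisation_empty: "safe_linearisation X {} l {#}"
  by (simp add: safe_linearisation_def bij_betw_def lessThan_def)

lemma otype_empty [simp]: "otype {} = {#}"
  using otype_le[of "{}" "{#}"] by (simp add: order.antisym)

text \<open>Here every linear extension is safe: entries of \<open>p\<close> placed after
  \<open>x\<close> are not below \<open>x\<close>, so \<open>x\<close> lies in their residual and
  keeps its friend.\<close>

lemma strongly_safe_linearisation:
  assumes V: "strongly_safe X V" "X \<subseteq> U" and h: "T \<subseteq> V" "bij_betw h T {..<H}"
    and mono: "\<And>x y. x \<in> T \<Longrightarrow> y \<in> T \<Longrightarrow> le x y \<Longrightarrow> x \<noteq> y \<Longrightarrow> h x < h y"
  shows "safe_linearisation X T h H"
  unfolding safe_linearisation_def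
proof (intro conjI ballI allI impI)
  show "T \<subseteq> X"
    using V(1) h(1) by (auto simp: strongly_safe_def)
  fix p x assume p: "set p \<subseteq> T \<and> x \<in> T \<and> (\<forall>y\<in>set p. h x < h y)"
  have "\<not> le y x" if "y \<in> set p" for y
  proof
    assume "le y x"
    moreover have "y \<in> T" "h x < h y"
      using p that by auto
    ultimately show False
      using mono[of y x] p by (cases "x = y") auto
  qed
  then have "x \<in> not_above_part V le p"
    using p h(1) by (auto simp: not_above_part_iff)
  then show "has_friend X p x"
    using p h(1) by (intro strongly_safe_has_friend[OF V(1)]) auto
qed (use h mono in auto)

text \<open>A strictly increasing map of ordinals never falls below the identity: a drop
  \<open>h x < l x\<close> would recur at the element in position \<open>h x\<close>.\<close>

lemma le_bij_betw_lessThan: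
  fixes l h :: "'b \<Rightarrow> 'o::wellorder"
  assumes "bij_betw l T {..<M}" "\<And>x y. x \<in> T \<Longrightarrow> y \<in> T \<Longrightarrow> l x < l y \<Longrightarrow> h x < h y" "x \<in> T"
  shows "l x \<le> h x"
  using assms(3)
proof (induction "l x" arbitrary: x rule: less_induct)
  case less
  show ?case
  proof (rule ccontr)
    assume "\<not> ?thesis"
    then have lt: "h x < l x"
      by simp
    moreover have "l x < M"
      using assms(1) less.prems by (auto simp: bij_betw_def)
    ultimately obtain y where y: "y \<in> T" "l y = h x"
      using assms(1) by (metis bij_betw_def imageE lessThan_iff order.strict_trans)
    then have "l y \<le> h y" "h y < h x"
      using less.hyps[of y] assms(2)[of y x] lt less.prems by auto
    with y show False by simp
  qed
qed

text \<open>A cofinal subset that is minimal with respect to residuals yields, by Zorn's lemma, a chain \<open>C\<close> whose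
  residuals cover \<open>V\<close> and have fast growing types.\<close>

lemma ex_cofinal_chain:
  assumes V: "V \<subseteq> U" "otype V = {#a#}" and a: "0 < a"
  obtains C where "C \<subseteq> V" "\<And>N. N < {#a#} \<Longrightarrow> \<exists>c\<in>C. N \<le> otype (not_above V c)"
    "\<And>c d. c \<in> C \<Longrightarrow> d \<in> C \<Longrightarrow> c = d \<or> otype (not_above V c) \<noteq> otype (not_above V d)"
    "\<And>c d. c \<in> C \<Longrightarrow> d \<in> C \<Longrightarrow> otype (not_above V c) < otype (not_above V d) \<Longrightarrow> le c d \<and>
      otype (not_above V c) \<le> otype (not_above V d - not_above V c)"
proof -
  define psi where "psi t = otype (not_above V t)" for t
  define cof where "cof I \<longleftrightarrow> (\<forall>N<{#a#}. \<exists>t\<in>I. N \<le> psi t)" for I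
  have psi: "psi t < {#a#}" if "t \<in> V" for t
    using otype_less[OF V(1) that] V(2) by (simp add: psi_def)
  have "cof V"
    unfolding cof_def psi_def using otype_le[OF V(1)] V(2) by (metis not_le)
  have "\<exists>I\<subseteq>V. cof I \<and> (\<forall>t\<in>I. \<not> cof (not_above I t))" if "W \<subseteq> V" "cof W" for W
  proof -
    have "W \<subseteq> U" using that V by blast
    then show ?thesis
      using that
    proof (induction W rule: subset_induct)
      case (step W)
      then show ?case
        by (meson not_above_part_subset subset_trans)
    qed
  qed
  from this[OF order_refl \<open>cof V\<close>] obtain I where I: "I \<subseteq> V" "cof I"
    and not_cof: "\<And>t. t \<in> I \<Longrightarrow> \<not> cof (not_above I t)"
    by blast
  then have "\<forall>t\<in>I. \<exists>N<{#a#}. \<forall>u\<in>not_above I t. psi u < N"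
    by (auto simp: cof_def not_le)
  \<comment> \<open>An element of \<open>I\<close> whose residual in \<open>V\<close> has type at
    least \<open>g t\<close> must lie above \<open>t\<close>.\<close>
  then obtain g where g: "\<And>t. t \<in> I \<Longrightarrow> g t < {#a#}"
    "\<And>t u. t \<in> I \<Longrightarrow> u \<in> not_above I t \<Longrightarrow> psi u < g t"
    by metis
  \<comment> \<open>\<open>G t\<close> dominates \<open>g t\<close> and twice \<open>psi t\<close>
    and strictly exceeds \<open>psi t\<close>. It stays below \<omega>^a, which is closed under sums
    and exceeds 1 as a > 0.\<close>
  define G where "G t = g t + (psi t + psi t + {#0#})" for t
  have G: "G t < {#a#}" if "t \<in> I" for t
    using g(1)[OF that] psi[of t] that I(1) a by (auto simp: G_def)
  have g_le_G: "g t \<le> G t" for t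
    by (simp add: G_def add.commute less_eq_multiset_plus_left)
  have psi_le_G: "psi t + psi t \<le> G t" for t
    unfolding G_def by (metis add.assoc add.commute less_eq_multiset_plus_left)
  have psi_less_G: "psi t < G t" for t
  proof -
    have "psi t < psi t + (g t + psi t + {#0#})"
      by (rule le_multiset_plus_left_nonempty[of _ "psi t", unfolded add.commute[of _ "psi t"]]) simp
    then show ?thesis
      by (simp add: G_def ac_simps)
  qed
  \<comment> \<open>Residual types in such a set are separated by jumps of \<open>G\<close>. A
    maximal set of this kind is cofinal, since otherwise some \<open>u\<close> with a large enough
    residual could be added.\<close>
  define A where "A = {C. C \<subseteq> I \<and> (\<forall>c\<in>C. \<forall>d\<in>C. c = d \<or> G c \<le> psi d \<or> G d \<le> psi c)}"
  have "\<exists>C\<in>A. \<forall>D\<in>A. C \<subseteq> D \<longrightarrow> D = C"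
  proof (rule subset_Zorn')
    fix \<C> assume ch: "subset.chain A \<C>"
    have "c = d \<or> G c \<le> psi d \<or> G d \<le> psi c" if "c \<in> X" "d \<in> Y" "X \<in> \<C>" "Y \<in> \<C>" for c d X Y
    proof -
      have "X \<subseteq> Y \<or> Y \<subseteq> X" "X \<in> A" "Y \<in> A"
        using ch that by (auto simp: subset_chain_def)
      with that(1,2) show ?thesis
        unfolding A_def by blast
    qed
    moreover have "\<Union>\<C> \<subseteq> I"
      using ch by (auto simp: subset_chain_def A_def)
    ultimately show "\<Union>\<C> \<in> A"
      unfolding A_def by blast
  qed
  then obtain C where C: "C \<in> A" and max: "\<And>D. D \<in> A \<Longrightarrow> C \<subseteq> D \<Longrightarrow> D = C"
    by blast
  have CI: "C \<subseteq> I" and sep: "\<And>c d. c \<in> C \<Longrightarrow> d \<in> C \<Longrightarrow> c = d \<or> G c \<le> psi d \<or> G d \<le> psi c"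
    using C by (auto simp: A_def)
  show thesis
  proof (rule that)
    show "C \<subseteq> V"
      using CI I(1) by blast
    show "\<exists>c\<in>C. N \<le> otype (not_above V c)" if N: "N < {#a#}" for N
    proof (rule ccontr)
      assume "\<not> ?thesis"
      then have small: "psi c < N" if "c \<in> C" for c
        using that by (auto simp: psi_def not_le)
      obtain K where K: "K < {#a#}" "\<And>c. c \<in> C \<Longrightarrow> G c \<le> K"
      proof (cases "\<exists>c\<in>C. N \<le> G c")
        case True
        then obtain c0 where c0: "c0 \<in> C" "N \<le> G c0" by blast
        show ?thesis
        proof (rule that[OF G])
          fix c assume "c \<in> C"
          with sep[OF this c0(1)] show "G c \<le> G c0"
            using small[OF \<open>c \<in> C\<close>] small[OF c0(1)] c0(2) psi_less_G[of c0] by auto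
        qed (use c0 CI in blast)
      qed (use that[OF N] in \<open>auto simp: not_le less_imp_le\<close>)
      obtain u where u: "u \<in> I" "K \<le> psi u"
        using I(2) K(1) by (auto simp: cof_def)
      have "G c \<le> psi u" if "c \<in> C" for c
        using K(2)[OF that] u(2) by simp
      then have "insert u C \<in> A"
        using C u(1) unfolding A_def by blast
      then have "u \<in> C"
        using max[of "insert u C"] by blast
      then show False
        using K(2)[of u] u(2) psi_less_G[of u] by simp
    qed
    show "c = d \<or> otype (not_above V c) \<noteq> otype (not_above V d)" if "c \<in> C" "d \<in> C" for c d
      using sep[OF that] psi_less_G[of c] psi_less_G[of d] by (auto simp: psi_def)
    show "le c d \<and> otype (not_above V c) \<le> otype (not_above V d - not_above V c)"
      if cd: "c \<in> C" "d \<in> C" "otype (not_above V c) < otype (not_above V d)" for c d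
    proof
      have Gc: "G c \<le> psi d"
        using sep[OF cd(1,2)] cd(3) psi_less_G[of d] by (auto simp: psi_def)
      show "le c d"
      proof (rule ccontr)
        assume "\<not> le c d"
        then have "psi d < g c"
          using cd CI by (intro g(2)) (auto simp: not_above_part_iff)
        with Gc g_le_G[of c] show False by simp
      qed
      \<comment> \<open>Twice \<open>psi c\<close> fits below \<open>psi d\<close>; by subadditivity
        one copy remains for the difference.\<close>
      have "psi c + psi c \<le> psi d"
        using psi_le_G[of c] Gc by simp
      also have "\<dots> \<le> otype (not_above V c \<union> (not_above V d - not_above V c))"
        unfolding psi_def using V(1) not_above_part_subset by (intro otype_mono) blast+
      also have "\<dots> \<le> psi c + otype (not_above V d - not_above V c)"
        unfolding psi_def using V(1) not_above_part_subset by (intro otype_Un) blast+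
      finally show "otype (not_above V c) \<le> otype (not_above V d - not_above V c)"
        by (simp add: psi_def)
    qed
  qed
qed

lemma friendly_rank_eq_type:
  assumes "strongly_safe X V" "X \<subseteq> U" "W \<subseteq> V"
  shows "friendly_rank X W = otype W"
  by (rule friendly_rank_strongly_safe[OF strongly_safe_subset[OF assms(1,3)]])
    (use assms in \<open>auto simp: strongly_safe_def\<close>)

text \<open>The chain of \<open>ex_cofinal_chain\<close> cuts \<open>V\<close> into layers of type
  below \<omega>^a. Each is linearised in its full type by \<open>IH\<close>, and the layers are
  placed one after another; since their types are cofinal in \<omega>^a, so is the length
  reached.\<close>

lemma ex_linearisation_single:
  assumes V: "strongly_safe X V" "X \<subseteq> U" "otype V = {#a#}"
    and IH: "\<And>W. W \<subseteq> V \<Longrightarrow> otype W < {#a#} \<Longrightarrow> \<exists>T l. T \<subseteq> W \<and> safe_linearisation X T l (otype W)"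
  shows "\<exists>T l. T \<subseteq> V \<and> safe_linearisation X T l {#a#}"
proof (cases "a = 0")
  case True
  have "V \<noteq> {}"
    using V(3) by auto
  then obtain v where v: "v \<in> V" by blast
  have "bij_betw (\<lambda>_. {#}) {v} {..<{#a#}}"
    using True by (auto simp: bij_betw_def)
  then have "safe_linearisation X {v} (\<lambda>_. {#}) {#a#}"
    by (rule strongly_safe_linearisation[OF V(1,2), rotated]) (use v in auto)
  with v show ?thesis by blast
next
  case False
  then have a: "0 < a"
    by (simp add: order.not_eq_order_implies_strict)
  have VU: "V \<subseteq> U"
    using V(1,2) by (auto simp: strongly_safe_def)
  define psi where "psi t = otype (not_above V t)" for t
  obtain C where C: "C \<subseteq> V"
    and cof: "\<And>N. N < {#a#} \<Longrightarrow> \<exists>c\<in>C. N \<le> psi c"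
    and inj': "\<And>c d. c \<in> C \<Longrightarrow> d \<in> C \<Longrightarrow> c = d \<or> psi c \<noteq> psi d"
    and chain': "\<And>c d. c \<in> C \<Longrightarrow> d \<in> C \<Longrightarrow> psi c < psi d \<Longrightarrow>
      le c d \<and> psi c \<le> otype (not_above V d - not_above V c)"
    by (rule ex_cofinal_chain[OF VU V(3) a], rule that, unfold psi_def)
  have inj: "c = d" if "c \<in> C" "d \<in> C" "psi c = psi d" for c d
    using inj'[OF that(1,2)] that(3) by blast
  have chain: "le c d" and grow: "psi c \<le> otype (not_above V d - not_above V c)"
    if "c \<in> C" "d \<in> C" "psi c < psi d" for c d
    using chain'[OF that] by blast+
  have psi: "psi t < {#a#}" if "t \<in> V" for t
    using otype_less[OF VU that] V(3) by (simp add: psi_def)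
  have add_zero: "N + {#0#} < {#a#}" if "N < {#a#}" for N
    using that a by simp
  \<comment> \<open>The first element of the chain that is not below \<open>x\<close>, named by the
    type of its residual; \<open>psi\<close> is injective on \<open>C\<close>.\<close>
  define lay where "lay x = (LEAST N. \<exists>c\<in>C. psi c = N \<and> \<not> le c x)" for x
  have lay: "\<exists>c\<in>C. psi c = lay x \<and> \<not> le c x" if x: "x \<in> V" for x
  proof -
    obtain c where c: "c \<in> C" "psi x + {#0#} \<le> psi c"
      using cof[OF add_zero[OF psi[OF x]]] by blast
    have "\<not> le c x"
    proof
      assume "le c x"
      then have "le c y" if "y \<in> V" "le x y" for y
        using le_trans[of c x y] that x c(1) C VU by blast
      then have "not_above V c \<subseteq> not_above V x"
        by (auto simp: not_above_part_iff)
      then have "psi c \<le> psi x"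
        unfolding psi_def using VU not_above_part_subset by (intro otype_mono) blast+
      with c(2) have "psi x + {#0#} \<le> psi x"
        by order
      moreover have "psi x < psi x + {#0#}"
        using le_multiset_right_total[of "psi x" 0] by simp
      ultimately show False
        by order
    qed
    with c(1) have "\<exists>c'\<in>C. psi c' = psi c \<and> \<not> le c' x"
      by blast
    from LeastI[of "\<lambda>N. \<exists>c\<in>C. psi c = N \<and> \<not> le c x", OF this] show ?thesis
      unfolding lay_def .
  qed
  have lay_le: "lay x \<le> psi c" if "c \<in> C" "\<not> le c x" for x c
    unfolding lay_def
    by (rule Least_le[of "\<lambda>N. \<exists>c\<in>C. psi c = N \<and> \<not> le c x"]) (use that in blast)
  have lay_mono: "lay x \<le> lay y" if xy: "x \<in> V" "y \<in> V" "le x y" for x y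
  proof -
    obtain c where c: "c \<in> C" "psi c = lay y" "\<not> le c y"
      using lay[OF xy(2)] by blast
    then have "\<not> le c x"
      using xy C VU le_trans by blast
    with c lay_le show ?thesis by metis
  qed
  define W where "W N = {x \<in> V. lay x = N}" for N
  have "\<exists>T l. T \<subseteq> W N \<and> safe_linearisation X T l (otype (W N))" for N
  proof (rule IH)
    show "otype (W N) < {#a#}"
    proof (cases "W N = {}")
      case False
      then obtain x where x: "x \<in> V" "lay x = N"
        by (auto simp: W_def)
      obtain c where c: "c \<in> C" "psi c = N"
        using lay[OF x(1)] x(2) by blast
      have "W N \<subseteq> not_above V c"
      proof
        fix y assume "y \<in> W N"
        then have y: "y \<in> V" "lay y = psi c"
          using c(2) by (auto simp: W_def)
        then obtain d where "d \<in> C" "psi d = psi c" "\<not> le d y"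
          using lay by metis
        then show "y \<in> not_above V c"
          using inj c(1) y(1) by (auto simp: not_above_part_iff)
      qed
      then have "otype (W N) \<le> psi c"
        unfolding psi_def using VU not_above_part_subset by (intro otype_mono) blast+
      also have "\<dots> < {#a#}"
        using c(1) C psi by blast
      finally show ?thesis .
    qed simp
  qed (auto simp: W_def)
  then obtain Tf lf where Tf: "\<And>N. Tf N \<subseteq> W N"
    and lf: "\<And>N. safe_linearisation X (Tf N) (lf N) (otype (W N))"
    by metis
  define T where "T = (\<Union>N. Tf N)"
  have TV: "T \<subseteq> V" and T_lay: "\<And>x. x \<in> T \<Longrightarrow> x \<in> Tf (lay x)"
    using Tf by (auto simp: T_def W_def)
  define lt where "lt x y \<longleftrightarrow> lay x < lay y \<or> lay x = lay y \<and> lf (lay x) x < lf (lay x) y" for x y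
  have lt_ext: "lt x y" if "x \<in> T" "y \<in> T" "le x y" "x \<noteq> y" for x y
  proof (cases "lay x = lay y")
    case True
    then have "lf (lay x) x < lf (lay x) y"
      using that T_lay[of x] T_lay[of y] by (intro safe_linearisationD(3)[OF lf[of "lay x"]]) auto
    with True show ?thesis
      by (simp add: lt_def)
  next
    case False
    have "lay x \<le> lay y"
      using that TV by (intro lay_mono) auto
    with False show ?thesis
      by (simp add: lt_def)
  qed
  obtain h and H :: "'a ordinal multiset" where h: "bij_betw h T {..<H}" "H \<le> otype T"
    "\<And>x y. x \<in> T \<Longrightarrow> y \<in> T \<Longrightarrow> lt x y \<Longrightarrow> h x < h y"
  proof (rule ex_order_type[of T lt])
    show "T \<subseteq> U"
      using TV VU by blast
    show "lt x y \<or> lt y x" if "x \<in> T" "y \<in> T" "x \<noteq> y" for x y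
    proof (cases "lay x = lay y")
      case True
      then have "lf (lay x) x \<noteq> lf (lay x) y"
        using that T_lay[of x] T_lay[of y] safe_linearisationD(2)[OF lf[of "lay x"]]
        by (auto simp: bij_betw_def inj_on_def)
      with True show ?thesis
        by (auto simp: lt_def neq_iff)
    qed (auto simp: lt_def neq_iff)
    show "lt x z" if "lt x y" "lt y z" for x y z
      using that unfolding lt_def by auto
    show "lt x y" if "x \<in> T" "y \<in> T" "le x y" "x \<noteq> y" for x y
      by (rule lt_ext[OF that])
  qed (auto simp: lt_def)
  \<comment> \<open>If \<open>H\<close> were smaller, some \<open>c\<close> would have a residual of
    type above \<open>H\<close>. The elements above \<open>c\<close> but not above its successor
    \<open>d\<close> in the chain lie in one layer, whose type therefore exceeds \<open>H\<close>
    too. The element at position \<open>H\<close> of that layer cannot come earlier in the whole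
    order.\<close>
  have "{#a#} \<le> H"
  proof (rule ccontr)
    assume "\<not> ?thesis"
    then have H: "H < {#a#}"
      by (simp only: not_le)
    then obtain c where c: "c \<in> C" "H + {#0#} \<le> psi c"
      using cof[OF add_zero] by blast
    have "psi c < {#a#}"
      using c(1) C psi by blast
    then obtain d' where d': "d' \<in> C" "psi c + {#0#} \<le> psi d'"
      using cof[OF add_zero] by blast
    moreover have "psi c < psi c + {#0#}"
      using le_multiset_right_total[of "psi c" 0] by simp
    ultimately have "psi c < psi d'"
      by order
    with d'(1) have ex: "\<exists>d\<in>C. psi d = psi d' \<and> psi c < psi d'"
      by blast
    define N where "N = (LEAST N. \<exists>d\<in>C. psi d = N \<and> psi c < N)"
    obtain d where d: "d \<in> C" "psi d = N" "psi c < N"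
      using LeastI[of "\<lambda>N. \<exists>d\<in>C. psi d = N \<and> psi c < N", OF ex] unfolding N_def by blast
    have "not_above V d - not_above V c \<subseteq> W N"
    proof
      fix x assume "x \<in> not_above V d - not_above V c"
      then have x: "x \<in> V" "\<not> le d x" "le c x"
        by (auto simp: not_above_part_iff)
      obtain e where e: "e \<in> C" "psi e = lay x" "\<not> le e x"
        using lay[OF x(1)] by blast
      have "psi c < psi e"
      proof (rule ccontr)
        assume "\<not> ?thesis"
        then have "e = c \<or> le e c"
          using inj[OF e(1) c(1)] chain[OF e(1) c(1)] by (auto simp: not_less le_less)
        then have "le e x"
          using x e(1) c(1) C VU le_trans by blast
        with e(3) show False by simp
      qed
      with e have "\<exists>d\<in>C. psi d = lay x \<and> psi c < lay x"
        by auto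
      then have "N \<le> lay x"
        unfolding N_def
        by (rule Least_le[of "\<lambda>N. \<exists>d\<in>C. psi d = N \<and> psi c < N"])
      moreover have "lay x \<le> N"
        using lay_le[OF d(1) x(2)] d(2) by simp
      ultimately show "x \<in> W N"
        using x(1) by (simp add: W_def)
    qed
    then have "otype (not_above V d - not_above V c) \<le> otype (W N)"
      using VU by (intro otype_mono) (auto simp: W_def)
    with grow[OF c(1) d(1)] d(2,3) c(2) have "H + {#0#} \<le> otype (W N)"
      by auto
    moreover have "H < H + {#0#}"
      using le_multiset_right_total[of H 0] by simp
    ultimately have "H < otype (W N)"
      by order
    then obtain x where x: "x \<in> Tf N" "lf N x = H"
      using safe_linearisationD(2)[OF lf[of N]] by (metis bij_betw_def imageE lessThan_iff)
    have "lf N x \<le> h x"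
    proof (rule le_bij_betw_lessThan[OF safe_linearisationD(2)[OF lf[of N]] _ x(1)])
      fix x y assume xy: "x \<in> Tf N" "y \<in> Tf N" "lf N x < lf N y"
      then have "lt x y"
        using Tf[of N] by (auto simp: lt_def W_def)
      with xy show "h x < h y"
        by (intro h(3)) (auto simp: T_def)
    qed
    moreover have "h x < H"
      using h(1) x(1) by (auto simp: bij_betw_def T_def)
    ultimately show False
      using x(2) by simp
  qed
  moreover have "H \<le> {#a#}"
    using h(2) otype_mono[OF TV VU] unfolding V(3) by order
  ultimately have "H = {#a#}"
    by order
  with h(1) have bij: "bij_betw h T {..<{#a#}}"
    by simp
  have "safe_linearisation X T h {#a#}"
  proof (rule strongly_safe_linearisation[OF V(1,2) TV bij])
    show "h x < h y" if "x \<in> T" "y \<in> T" "le x y" "x \<noteq> y" for x y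
      by (rule h(3)[OF that(1,2) lt_ext[OF that]])
  qed
  with TV show ?thesis by blast
qed

section \<open>Friendly elements\<close>

text \<open>Choose \<open>z\<close> with a residual of least type. A smaller \<open>y\<close> would
  lie in that residual and have a residual of still smaller type.\<close>

lemma ex_minimal:
  assumes "A \<subseteq> U" "A \<noteq> {}"
  shows "\<exists>z\<in>A. \<forall>y\<in>A. le y z \<longrightarrow> y = z"
proof -
  define N where "N = (LEAST N. \<exists>z\<in>A. otype (not_above A z) = N)"
  have "\<exists>z\<in>A. otype (not_above A z) = N"
    unfolding N_def by (rule LeastI_ex) (use assms(2) in blast)
  then obtain z where z: "z \<in> A" "otype (not_above A z) = N" by blast
  have "y = z" if y: "y \<in> A" "le y z" for y
  proof (rule ccontr)
    assume "y \<noteq> z"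
    then have "y \<in> not_above A z"
      using y z(1) assms(1) le_antisym by (auto simp: not_above_part_iff)
    then have "otype (not_above (not_above A z) y) < N"
      using assms(1) not_above_part_subset z(2) by (metis subset_trans otype_less)
    moreover have "le y x" if "x \<in> A" "le z x" for x
      using le_trans[OF y(2) that(2)] y(1) z(1) that(1) assms(1) by blast
    then have "not_above (not_above A z) y = not_above A y"
      by (auto simp: not_above_part_iff)
    moreover have "N \<le> otype (not_above A y)"
      unfolding N_def by (rule Least_le) (use y in blast)
    ultimately show False by simp
  qed
  with z(1) show ?thesis by blast
qed

text \<open>Classify the friendly elements by the distance from a minimal element of their component in the
  incomparability graph.  An element at positive distance has a friend one step closer, and
  distances are monotone within a component.  Hence elements at distance 0, at odd and at positive
  even distance form strongly safe sets: incomparable elements of one class are equally far.\<close>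

lemma friendly_decomposition:
  assumes XU: "X \<subseteq> U"
  obtains V :: "nat \<Rightarrow> 'a set" where "\<And>i. strongly_safe X (V i)"
    "{x \<in> X. has_friend X [] x} = V 0 \<union> V 1 \<union> V 2"
proof -
  define inc where "inc = {(x, y). x \<in> X \<and> y \<in> X \<and> incomparable le x y}"
  have sym: "(y, x) \<in> inc" if "(x, y) \<in> inc" for x y
    using that by (auto simp: inc_def incomparable_def)
  have sym_rtrancl: "(y, x) \<in> inc\<^sup>*" if "(x, y) \<in> inc\<^sup>*" for x y
    by (rule rtrancl_induct[OF that]) (auto intro: converse_rtrancl_into_rtrancl sym)
  define comp where "comp x = {y. (x, y) \<in> inc\<^sup>*}" for x
  \<comment> \<open>The choice depends only on the component, so incomparable elements share their
    root.\<close>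
  define z where "z x = (SOME z. z \<in> comp x \<and> (\<forall>y\<in>comp x. le y z \<longrightarrow> y = z))" for x
  define dist where "dist x = (LEAST n. (z x, x) \<in> inc ^^ n)" for x
  have comp_eq: "comp x = comp y" if "(x, y) \<in> inc" for x y
    using that sym[OF that] by (auto simp: comp_def intro: converse_rtrancl_into_rtrancl)
  then have z_eq: "z x = z y" if "(x, y) \<in> inc" for x y
    unfolding z_def using that by metis
  have comp_subset: "comp x \<subseteq> X" if "x \<in> X" for x
  proof
    fix y assume "y \<in> comp x"
    then have "(x, y) \<in> inc\<^sup>*"
      by (simp add: comp_def)
    then show "y \<in> X"
      using that by (induction rule: rtrancl_induct) (auto simp: inc_def)
  qed
  have z: "z x \<in> comp x" "\<And>y. y \<in> comp x \<Longrightarrow> le y (z x) \<Longrightarrow> y = z x" if "x \<in> X" for x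
  proof -
    have "x \<in> comp x"
      by (simp add: comp_def)
    then have "\<exists>z. z \<in> comp x \<and> (\<forall>y\<in>comp x. le y z \<longrightarrow> y = z)"
      using ex_minimal[of "comp x"] comp_subset[OF that] XU by blast
    then have "z x \<in> comp x \<and> (\<forall>y\<in>comp x. le y (z x) \<longrightarrow> y = z x)"
      unfolding z_def by (rule someI_ex)
    then show "z x \<in> comp x" "\<And>y. y \<in> comp x \<Longrightarrow> le y (z x) \<Longrightarrow> y = z x"
      by blast+
  qed
  have dist: "(z x, x) \<in> inc ^^ dist x" if "x \<in> X" for x
  proof -
    have "(z x, x) \<in> inc\<^sup>*"
      by (rule sym_rtrancl) (use z(1)[OF that] in \<open>simp add: comp_def\<close>)
    then obtain n where "(z x, x) \<in> inc ^^ n"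
      by (auto dest: rtrancl_imp_relpow)
    from LeastI[of "\<lambda>n. (z x, x) \<in> inc ^^ n", OF this] show ?thesis
      unfolding dist_def .
  qed
  have dist_le: "dist x \<le> n" if "(z x, x) \<in> inc ^^ n" for x n
    unfolding dist_def by (rule Least_le[of "\<lambda>n. (z x, x) \<in> inc ^^ n", OF that])
  have dist_Suc: "dist y \<le> Suc (dist x)" if "(x, y) \<in> inc" for x y
  proof -
    have "x \<in> X" using that by (simp add: inc_def)
    then show ?thesis
      using dist[of x] that z_eq[OF that] by (intro dist_le) auto
  qed
  have parent: "\<exists>p. (p, x) \<in> inc \<and> dist p = k" if x: "x \<in> X" "dist x = Suc k" for x k
  proof -
    obtain p where p: "(z x, p) \<in> inc ^^ k" "(p, x) \<in> inc"
      using dist[OF x(1)] x(2) by auto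
    then have "dist p \<le> k"
      using z_eq[OF p(2)] by (intro dist_le) simp
    moreover have "Suc k \<le> Suc (dist p)"
      using dist_Suc[OF p(2)] x(2) by simp
    ultimately show ?thesis
      using p(2) by (intro exI[of _ p]) simp
  qed
  have dist_0: "x = z x" if "x \<in> X" "dist x = 0" for x
    using dist[OF that(1)] that(2) by simp
  \<comment> \<open>Compare \<open>f\<close> with a neighbour \<open>q\<close> of \<open>u\<close>
    one step closer to the root. If \<open>f\<close> is below \<open>q\<close>, induction applies;
    \<open>q\<close> below \<open>f\<close> would put \<open>q\<close> below \<open>u\<close>; and
    if they are incomparable, \<open>f\<close> is at most one step farther than
    \<open>q\<close>.\<close>
  have dist_mono: "dist f \<le> dist u" if "f \<in> X" "u \<in> X" "z f = z u" "le f u" for f u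
    using that
  proof (induction "dist u" arbitrary: u)
    case 0
    then have "u = z f"
      using dist_0[of u] by simp
    then have "f = u"
      using z(2)[OF 0(2), of f] 0(5) by (simp add: comp_def)
    then show ?case by simp
  next
    case (Suc k)
    obtain q where q: "(q, u) \<in> inc" "dist q = k"
      using parent[OF Suc.prems(2)] Suc.hyps(2) by metis
    have qX: "q \<in> X" and inc_q: "\<not> le q u"
      using q(1) by (auto simp: inc_def incomparable_def)
    consider "le f q" | "le q f" | "(q, f) \<in> inc"
      using qX Suc.prems(1) by (auto simp: inc_def incomparable_def)
    then show ?case
    proof cases
      case 1
      have "dist f \<le> dist q"
        using Suc.hyps(1)[of q] q Suc.prems z_eq[OF q(1)] qX 1 by simp
      then show ?thesis
        using q(2) Suc.hyps(2) by simp
    next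
      case 2
      then have "le q u"
        using Suc.prems qX XU le_trans by blast
      with inc_q show ?thesis by simp
    next
      case 3
      then show ?thesis
        using dist_Suc[OF 3] q(2) Suc.hyps(2) by simp
    qed
  qed
  define cl where "cl x = (if dist x = 0 then 0 else 1 + dist x mod 2)" for x
  define V where "V i = {x \<in> X. has_friend X [] x \<and> cl x = i}" for i
  show thesis
  proof (rule that)
    show "{x \<in> X. has_friend X [] x} = V 0 \<union> V 1 \<union> V 2"
      by (auto simp: V_def cl_def)
    show "strongly_safe X (V i)" for i
      unfolding strongly_safe_def
    proof (intro conjI ballI)
      show "V i \<subseteq> X"
        by (auto simp: V_def)
      fix x assume "x \<in> V i"
      then have x: "x \<in> X" "has_friend X [] x" "cl x = i"
        by (auto simp: V_def)
      \<comment> \<open>At positive distance the friend is taken one step closer to the root; at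
        distance 0 any friend will do.\<close>
      obtain y where y: "(y, x) \<in> inc" "dist x \<noteq> 0 \<Longrightarrow> dist y < dist x"
      proof (cases "dist x")
        case 0
        with x that show ?thesis
          by (auto simp: has_friend_iff inc_def)
      next
        case (Suc k)
        with parent[OF x(1)] that show ?thesis by auto
      qed
      have "le f x" if f: "f \<in> V i" "le f y" for f
      proof (rule ccontr)
        assume "\<not> le f x"
        moreover have fX: "f \<in> X" and yX: "y \<in> X" and "\<not> le x y"
          using f y by (auto simp: V_def inc_def incomparable_def)
        then have "\<not> le x f"
          using f(2) x(1) XU le_trans by blast
        ultimately have fx: "(f, x) \<in> inc"
          using fX x(1) by (simp add: inc_def incomparable_def)
        have cl: "cl f = cl x"
          using f(1) x(3) by (simp add: V_def)
        have "dist f = dist x"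
        proof -
          have "dist f \<le> Suc (dist x)" "dist x \<le> Suc (dist f)"
            using dist_Suc[OF fx] dist_Suc[OF sym[OF fx]] by simp_all
          then consider "dist f = dist x" | "dist f = Suc (dist x)" | "dist x = Suc (dist f)"
            by linarith
          then show ?thesis
            by cases (use cl in \<open>auto simp: cl_def mod_Suc split: if_splits\<close>)
        qed
        show False
        proof (cases "dist x = 0")
          case True
          then have "f = x"
            using dist_0[of f] dist_0[of x] fX x(1) z_eq[OF fx] \<open>dist f = dist x\<close> by simp
          with fx fX XU le_refl show False
            by (auto simp: inc_def incomparable_def)
        next
          case False
          have "dist f \<le> dist y"
            using z_eq[OF fx] z_eq[OF y(1)] by (intro dist_mono fX yX f(2)) simp
          with y(2)[OF False] \<open>dist f = dist x\<close> show False by simp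
        qed
      qed
      with y(1) show "\<exists>y\<in>X. incomparable le y x \<and> (\<forall>f\<in>V i. le f y \<longrightarrow> le f x)"
        by (auto simp: inc_def)
    qed
  qed
qed

section \<open>Safe sets of maximal type\<close>

text \<open>The descent of \<open>ex_subset_type_eq\<close>, with \<open>X\<close> and
  \<open>E\<close> passing to residuals together.\<close>

lemma ex_friendly_rank_eq:
  assumes "E \<subseteq> U" "M \<le> friendly_rank X E" "E \<subseteq> X"
  obtains X' E' where "X' \<subseteq> X" "E' \<subseteq> E" "E' \<subseteq> X'" "friendly_rank X' E' = M"
proof -
  have "\<exists>X' E'. X' \<subseteq> X \<and> E' \<subseteq> E \<and> E' \<subseteq> X' \<and> friendly_rank X' E' = M"
    using assms
  proof (induction E arbitrary: X rule: subset_induct)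
    case (step E)
    show ?case
    proof (cases "friendly_rank X E = M")
      case True
      with step.prems(2) show ?thesis by blast
    next
      case False
      with step.prems(1) have lt: "M < friendly_rank X E"
        by order
      obtain x where x: "x \<in> E" "M \<le> friendly_rank (not_above X x) (not_above E x)"
        using friendly_rank_le[OF step.hyps(1), of X M] lt by (meson leD not_le)
      have "not_above E x \<subseteq> not_above X x"
        using step.prems(2) by (auto simp: not_above_part_iff)
      from step.IH[OF x this] obtain X' E' where *: "X' \<subseteq> not_above X x" "E' \<subseteq> not_above E x" "E' \<subseteq> X'"
        "friendly_rank X' E' = M"
        by blast
      have "X' \<subseteq> X" "E' \<subseteq> E"
        using * not_above_part_subset by blast+
      with * show ?thesis by blast
    qed
  qed
  with that show thesis by blast
qed

text \<open>Friends above \<open>x1\<close> may be replaced by \<open>x0\<close>.\<close>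

lemma friendly_rank_not_above_le:
  assumes "X \<subseteq> U" "V \<subseteq> not_above X x0" "x0 \<in> X" "x1 \<in> X" "le x0 x1" "x0 \<noteq> x1"
  shows "friendly_rank X V \<le> friendly_rank (not_above X x1) V"
  unfolding friendly_rank_def
proof (rule bad_rank_mono[OF order_refl])
  show "V \<subseteq> U"
    using assms(1,2) not_above_part_subset by blast
  fix p v assume "set p \<subseteq> V" "v \<in> not_above_part V le p" and p: "has_friend X p v"
  then have v: "v \<in> X" "\<not> le x0 v"
    using assms(2) by (auto simp: not_above_part_iff)
  have pU: "set p \<subseteq> U"
    using \<open>set p \<subseteq> V\<close> assms(1,2) not_above_part_subset by blast
  obtain y where y: "y \<in> X" "incomparable le y v" "\<forall>z\<in>set p. \<not> le z y"
    using p by (auto simp: has_friend_iff)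
  show "has_friend (not_above X x1) p v"
  proof (cases "le x1 y")
    case False
    with y show ?thesis
      by (auto simp: has_friend_iff not_above_part_iff)
  next
    case True
    have yx0: "le x0 y"
      using le_trans[OF assms(5) True] assms(1,3,4) y(1) by blast
    have "\<not> le v x0"
      using le_trans[of v x0 y] yx0 y(1,2) v(1) assms(1,3) by (auto simp: incomparable_def)
    then have "incomparable le x0 v"
      using v(2) by (simp add: incomparable_def)
    moreover have "\<not> le x1 x0"
      using le_antisym[OF assms(5)] assms(1,3,4,6) by blast
    then have "x0 \<in> not_above X x1"
      using assms(3) by (simp add: not_above_part_iff)
    moreover have "\<not> le z x0" if "z \<in> set p" for z
      using le_trans[OF _ yx0, of z] that pU y(1,3) assms(1,3) by blast
    ultimately show ?thesis
      unfolding has_friend_iff by blast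
  qed
qed

text \<open>If a = 0, any friendly \<open>x\<close> with residual rank at least \<open>B\<close>
  itself gives rank 1 above \<open>x\<close>. Otherwise the rank is a limit, so there are moves with
  strictly increasing residual ranks, and among them some \<open>f i\<close> below some
  \<open>f j\<close>. The part not above \<open>f i\<close> then has rank at most
  \<open>psi (f j)\<close> even with all of \<open>X\<close> for friends, and subadditivity leaves
  \<omega>^a for the part above \<open>f i\<close>.\<close>

lemma ex_splitting_element:
  assumes EX: "E \<subseteq> X" "X \<subseteq> U" and rank: "friendly_rank X E = B + {#a#}"
    and a: "\<And>b. b \<in># B \<Longrightarrow> a \<le> b"
  obtains x where "x \<in> E" "B \<le> friendly_rank (not_above X x) (not_above E x)"
    "{#a#} \<le> friendly_rank X (E - not_above E x)"
proof -
  define psi where "psi x = friendly_rank (not_above X x) (not_above E x)" for x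
  define F where "F = {x \<in> E. has_friend X [] x}"
  have EU: "E \<subseteq> U"
    using EX by blast
  have cof: "\<exists>x\<in>F. N \<le> psi x" if "N < B + {#a#}" for N
  proof (rule ccontr)
    assume "\<not> ?thesis"
    then have "friendly_rank X E \<le> N"
      by (intro friendly_rank_le[OF EU]) (auto simp: F_def psi_def not_le)
    with that rank show False
      by (simp only: not_le[symmetric])
  qed
  have psi: "psi x < B + {#a#}" if "x \<in> F" for x
    using friendly_rank_less[OF EU, of x X] that rank by (simp add: F_def psi_def)
  have B: "B < B + {#a#}"
    by (simp add: le_multiset_right_total)
  show thesis
  proof (cases "a = 0")
    case True
    obtain x where x: "x \<in> F" "B \<le> psi x"
      using cof[OF B] by blast
    have "x \<in> E - not_above E x"
      using x(1) EU le_refl by (auto simp: F_def not_above_part_iff)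
    then have "{#a#} \<le> friendly_rank X (E - not_above E x)"
      using friendly_rank_pos[of "E - not_above E x" x X] True x(1) EU by (auto simp: F_def)
    with x that show thesis
      by (auto simp: F_def psi_def)
  next
    case False
    have step: "\<exists>y. y \<in> F \<and> psi x < psi y" if "x \<in> F" for x
    proof -
      have "psi x + {#0#} \<le> B + {#a#}"
        by (rule add_zero_mset_le[OF psi[OF that]])
      moreover have "0 \<notin># B + {#a#}"
      proof
        assume "0 \<in># B + {#a#}"
        then have "a \<le> 0"
          using a[of 0] by auto
        with False show False
          by (simp add: order.antisym)
      qed
      then have "psi x + {#0#} \<noteq> B + {#a#}"
        by (metis multi_member_this union_iff add.commute union_single_eq_member)
      ultimately have "psi x + {#0#} < B + {#a#}"
        by order
      then obtain y where y: "y \<in> F" "psi x + {#0#} \<le> psi y"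
        using cof by blast
      moreover have "psi x < psi x + {#0#}"
        by (simp add: le_multiset_right_total)
      ultimately have "psi x < psi y"
        by order
      with y(1) show ?thesis by blast
    qed
    obtain x where x: "x \<in> F" "B \<le> psi x"
      using cof[OF B] by blast
    have "\<exists>f. \<forall>n. (f n \<in> F \<and> (n = 0 \<longrightarrow> B \<le> psi (f n))) \<and> psi (f n) < psi (f (Suc n))"
      by (rule dependent_nat_choice) (use x step in auto)
    then obtain f where f: "\<And>n. f n \<in> F" "B \<le> psi (f 0)" "\<And>n. psi (f n) < psi (f (Suc n))"
      by blast
    have "f n \<in> U" for n
      using f(1)[of n] EU by (auto simp: F_def)
    then obtain i j where ij: "i < j" "le (f i) (f j)"
      using ex_increasing_pair[of f] by blast
    have less: "psi (f m) < psi (f n)" if "m < n" for m n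
      using lift_Suc_mono_less[of "\<lambda>n. psi (f n)", OF f(3) that] .
    have Bi: "B \<le> psi (f i)"
      using f(2) less[of 0 i] by (cases "i = 0") auto
    have E0: "friendly_rank X (not_above E (f i)) \<le> psi (f j)"
    proof -
      have fi: "f i \<in> X" "f j \<in> X"
        using f(1)[of i] f(1)[of j] EX(1) by (auto simp: F_def)
      have sub: "not_above E (f i) \<subseteq> not_above X (f i)"
        using EX(1) by (auto simp: not_above_part_iff)
      have "f i \<noteq> f j"
        using less[OF ij(1)] by auto
      then have "friendly_rank X (not_above E (f i)) \<le> friendly_rank (not_above X (f j)) (not_above E (f i))"
        by (rule friendly_rank_not_above_le[OF EX(2) sub fi ij(2)])
      also have "le (f i) y" if "y \<in> E" "le (f j) y" for y
        using le_trans[OF ij(2) that(2)] fi that(1) EX EU by blast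
      then have "not_above E (f i) \<subseteq> not_above E (f j)"
        by (auto simp: not_above_part_iff)
      then have "friendly_rank (not_above X (f j)) (not_above E (f i)) \<le> psi (f j)"
        unfolding psi_def using EU not_above_part_subset by (intro friendly_rank_mono) blast+
      finally show ?thesis .
    qed
    let ?R = "friendly_rank X (E - not_above E (f i))"
    have "B + {#a#} \<le> friendly_rank X (not_above E (f i)) + ?R"
    proof -
      have "E = not_above E (f i) \<union> (E - not_above E (f i))"
        using not_above_part_subset by blast
      moreover have "friendly_rank X (not_above E (f i) \<union> (E - not_above E (f i))) \<le>
          friendly_rank X (not_above E (f i)) + ?R"
        using EU not_above_part_subset by (intro friendly_rank_Un) blast+
      ultimately show ?thesis
        using rank by simp
    qed
    also have "\<dots> \<le> psi (f j) + ?R"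
      by (rule add_right_mono[OF E0])
    finally have sum: "B + {#a#} \<le> psi (f j) + ?R" .
    have "B \<le> psi (f j)"
      using Bi less[OF ij(1)] by order
    \<comment> \<open>After cancelling the common head \<open>B\<close>, a tail \<open>D\<close>
      below \<omega>^a remains. As \<omega>^a is additively indecomposable, \<open>?R\<close> alone
      must reach it.\<close>
    then obtain D where D: "psi (f j) = B + D" "D < {#a#}"
      by (rule ordinal_multiset_remainder[OF _ _ psi[OF f(1)], rotated]) (use a in auto)
    have "{#a#} \<le> D + ?R"
      using sum unfolding D(1) by (simp add: add.assoc)
    then have "{#a#} \<le> ?R"
      using D(2) by (auto simp: not_less[symmetric] simp del: mset_le_single_right_iff)
    with Bi f(1)[of i] that show thesis
      by (auto simp: F_def psi_def)
  qed
qed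

text \<open>Induction on \<open>M\<close>, after shrinking to rank exactly \<open>M\<close>. The
  last term \<omega>^a is split off by \<open>ex_splitting_element\<close>, or is all of
  \<open>M\<close> and then carried by one class of \<open>friendly_decomposition\<close>. The bound
  on \<open>otype T\<close> will make the linearisation maximal.\<close>

theorem ex_safe_linearisation:
  assumes "X \<subseteq> U" "E \<subseteq> X" "M \<le> friendly_rank X E"
  shows "\<exists>T l. T \<subseteq> E \<and> safe_linearisation X T l M \<and> otype T \<le> M"
  using assms
proof (induction M arbitrary: X E rule: less_induct)
  case (less M)
  have "E \<subseteq> U"
    using less.prems by blast
  from ex_friendly_rank_eq[OF this less.prems(3,2)] obtain X' E' where X': "X' \<subseteq> X" "E' \<subseteq> E" "E' \<subseteq> X'"
    "friendly_rank X' E' = M" .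
  have X'U: "X' \<subseteq> U"
    using X'(1) less.prems(1) by blast
  have E'U: "E' \<subseteq> U"
    using X'U X'(3) by blast
  have "\<exists>T l. T \<subseteq> E' \<and> safe_linearisation X' T l M \<and> otype T \<le> M"
  proof (cases "M = {#}")
    case True
    then show ?thesis
      using safe_linearisation_empty by (intro exI[of _ "{}"]) auto
  next
    case False
    define a where "a = Min_mset M"
    define B where "B = M - {#a#}"
    have M: "M = B + {#a#}" and a: "\<And>x. x \<in># B \<Longrightarrow> a \<le> x"
      using False by (auto simp: a_def B_def dest: in_diffD)
    show ?thesis
    proof (cases "B = {#}")
      case True
      obtain V :: "nat \<Rightarrow> 'a set" where V: "\<And>i. strongly_safe X' (V i)"
        "{x \<in> X'. has_friend X' [] x} = V 0 \<union> V 1 \<union> V 2"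
        by (rule friendly_decomposition[OF X'U], rule that)
      \<comment> \<open>Elements outside the three classes have no friend and contribute rank 0, and
        three ranks below \<omega>^a cannot add up to it.\<close>
      have "\<exists>i. {#a#} \<le> friendly_rank X' (E' \<inter> V i)"
      proof (rule ccontr)
        assume "\<not> ?thesis"
        then have small: "friendly_rank X' (E' \<inter> V i) < {#a#}" for i
          using not_le by blast
        let ?A = "\<lambda>i. E' \<inter> V i"
        let ?R = "E' - (V 0 \<union> V 1 \<union> V 2)"
        have "M = friendly_rank X' (((?A 0 \<union> ?A 1) \<union> ?A 2) \<union> ?R)"
          unfolding X'(4)[symmetric] by (rule arg_cong[of _ _ "friendly_rank X'"]) blast
        also have "\<dots> \<le> friendly_rank X' ((?A 0 \<union> ?A 1) \<union> ?A 2) + friendly_rank X' ?R"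
          using E'U by (intro friendly_rank_Un) auto
        also have "\<dots> \<le> friendly_rank X' ((?A 0 \<union> ?A 1) \<union> ?A 2) + {#}"
          using E'U X'(3) V(2) by (intro add_left_mono friendly_rank_le) auto
        also have "\<dots> \<le> friendly_rank X' (?A 0 \<union> ?A 1) + friendly_rank X' (?A 2)"
          using E'U friendly_rank_Un[of "?A 0 \<union> ?A 1" "?A 2" X'] by auto
        also have "\<dots> \<le> (friendly_rank X' (?A 0) + friendly_rank X' (?A 1)) + friendly_rank X' (?A 2)"
          using E'U by (intro add_right_mono friendly_rank_Un) auto
        also have "\<dots> < {#a#}"
          using small[of 0] small[of 1] small[of 2] by auto
        finally show False
          using M True by simp
      qed
      then obtain i where i: "{#a#} \<le> friendly_rank X' (E' \<inter> V i)" by blast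
      also have "\<dots> \<le> otype (E' \<inter> V i)"
        using E'U by (intro friendly_rank_le_type) auto
      finally obtain W where W: "W \<subseteq> E' \<inter> V i" "otype W = {#a#}"
        using ex_subset_type_eq[of "E' \<inter> V i" "{#a#}"] E'U by blast
      have safe: "strongly_safe X' W"
        using V(1)[of i] W(1) by (intro strongly_safe_subset[OF V(1)[of i]]) blast
      have "\<exists>T l. T \<subseteq> W \<and> safe_linearisation X' T l {#a#}"
      proof (rule ex_linearisation_single[OF safe X'U W(2)])
        fix D assume D: "D \<subseteq> W" "otype D < {#a#}"
        have "\<exists>T l. T \<subseteq> D \<and> safe_linearisation X' T l (otype D) \<and> otype T \<le> otype D"
        proof (rule less.IH[OF _ X'U])
          show "otype D < M"
            using D(2) M True by simp
          show "D \<subseteq> X'"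
            using D(1) W(1) X'(3) by blast
          show "otype D \<le> friendly_rank X' D"
            using friendly_rank_eq_type[OF safe X'U D(1)] by simp
        qed
        then show "\<exists>T l. T \<subseteq> D \<and> safe_linearisation X' T l (otype D)"
          by blast
      qed
      then obtain T l where T: "T \<subseteq> W" "safe_linearisation X' T l {#a#}"
        by blast
      have WU: "W \<subseteq> U"
        using W(1) E'U by blast
      have "otype T \<le> {#a#}"
        using otype_mono[OF T(1) WU] unfolding W(2) .
      with T W(1) show ?thesis
        unfolding M True by (intro exI[of _ T] exI[of _ l]) auto
    next
      case False
      obtain x where x: "x \<in> E'" "B \<le> friendly_rank (not_above X' x) (not_above E' x)"
        "{#a#} \<le> friendly_rank X' (E' - not_above E' x)"
        by (rule ex_splitting_element[OF X'(3) X'U _ a]) (use X'(4) M in auto)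
      have "B < M" "{#a#} < M"
        using M False by (auto intro: subset_imp_less_mset)
      have "\<exists>T l. T \<subseteq> not_above E' x \<and> safe_linearisation (not_above X' x) T l B \<and> otype T \<le> B"
        using X'(3) X'U by (intro less.IH[OF \<open>B < M\<close> _ _ x(2)]) (auto simp: not_above_part_iff)
      then obtain T0 l0 where T0: "T0 \<subseteq> not_above E' x" and l0: "safe_linearisation (not_above X' x) T0 l0 B"
        and type0: "otype T0 \<le> B"
        by blast
      have "\<exists>T l. T \<subseteq> E' - not_above E' x \<and> safe_linearisation X' T l {#a#} \<and> otype T \<le> {#a#}"
        using X'(3) by (intro less.IH[OF \<open>{#a#} < M\<close> X'U _ x(3)]) auto
      then obtain T1 l1 where T1: "T1 \<subseteq> E' - not_above E' x" and l1: "safe_linearisation X' T1 l1 {#a#}"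
        and type1: "otype T1 \<le> {#a#}"
        by blast
      \<comment> \<open>Elements of \<open>T1\<close> are above \<open>x\<close> and those of
        \<open>T0\<close> are not, so no element of \<open>T0\<close> is above one of
        \<open>T1\<close> and \<open>T1\<close> may come last.\<close>
      define l where "l y = (if le x y then B + l1 y else l0 y)" for y
      have l_T0: "l y = l0 y" "l y < B" "y \<in> X'" "\<not> le x y" if "y \<in> T0" for y
      proof -
        have "y \<in> not_above E' x" "l0 y < B"
          using that T0 safe_linearisationD(2)[OF l0] by (auto simp: bij_betw_def)
        then show "l y = l0 y" "l y < B" "y \<in> X'" "\<not> le x y"
          using X'(3) by (auto simp: l_def not_above_part_iff)
      qed
      have l_T1: "l y = B + l1 y" "B \<le> l y" "y \<in> X'" "le x y" if "y \<in> T1" for y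
      proof -
        have "y \<in> E'" "le x y"
          using that T1 by (auto simp: not_above_part_iff)
        then show "l y = B + l1 y" "B \<le> l y" "y \<in> X'" "le x y"
          using X'(3) less_eq_multiset_plus_left[of B "l1 y"] by (auto simp: l_def add.commute)
      qed
      have "safe_linearisation X' (T0 \<union> T1) l M"
        unfolding safe_linearisation_def
      proof (intro conjI ballI allI impI)
        show "T0 \<union> T1 \<subseteq> X'"
          using l_T0 l_T1 by blast
        have "bij_betw l T0 {..<B}"
          using safe_linearisationD(2)[OF l0] l_T0(1) by (simp cong: bij_betw_cong)
        moreover have "bij_betw ((+) B \<circ> l1) T1 ((+) B ` {..<{#a#}})"
          using safe_linearisationD(2)[OF l1] by (rule bij_betw_trans) (auto simp: bij_betw_def)
        then have "bij_betw l T1 ((+) B ` {..<{#a#}})"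
          using l_T1(1) by (simp cong: bij_betw_cong)
        moreover have "{..<B} \<inter> (+) B ` {..<{#a#}} = {}"
        proof -
          have "\<not> B + N < B" for N
            using less_eq_multiset_plus_left[of B N] by (simp add: add.commute not_less)
          then show ?thesis by auto
        qed
        ultimately have "bij_betw l (T0 \<union> T1) ({..<B} \<union> (+) B ` {..<{#a#}})"
          by (rule bij_betw_combine)
        also have "{..<B} \<union> (+) B ` {..<{#a#}} = {..<M}"
          unfolding M using a by (intro lessThan_ordinal_multiset_add[symmetric]) simp
        finally show "bij_betw l (T0 \<union> T1) {..<M}" .
      next
        fix y z assume yz: "y \<in> T0 \<union> T1" "z \<in> T0 \<union> T1" "le y z \<and> y \<noteq> z"
        show "l y < l z"
        proof (cases "y \<in> T0")
          case y: True
          show ?thesis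
          proof (cases "z \<in> T0")
            case True
            then show ?thesis
              using y yz(3) l_T0(1) safe_linearisationD(3)[OF l0] by simp
          next
            case False
            then have "B \<le> l z"
              using yz(2) l_T1(2) by blast
            with l_T0(2)[OF y] show ?thesis
              by order
          qed
        next
          case False
          then have y: "y \<in> T1"
            using yz(1) by blast
          have "le x z"
            using le_trans[of x y z] l_T1(3,4)[OF y] yz(2,3) x(1) E'U X'U l_T0(3)[of z] l_T1(3)[of z] by blast
          then have "z \<in> T1"
            using yz(2) l_T0(4) by blast
          then show ?thesis
            using y yz(3) l_T1(1) safe_linearisationD(3)[OF l1] by simp
        qed
      next
        fix p y assume p: "set p \<subseteq> T0 \<union> T1 \<and> y \<in> T0 \<union> T1 \<and> (\<forall>z\<in>set p. l y < l z)"
        show "has_friend X' p y"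
        proof (cases "y \<in> T0")
          case y: True
          let ?q = "filter (\<lambda>z. z \<in> T0) p"
          \<comment> \<open>This friend is not above \<open>x\<close>, hence not above any entry of
            \<open>p\<close> from \<open>T1\<close> either.\<close>
          have "has_friend (not_above X' x) ?q y"
            using p l_T0(1) y by (intro safe_linearisationD(4)[OF l0]) auto
          then obtain f where f: "f \<in> X'" "\<not> le x f" "incomparable le f y" "\<And>z. z \<in> set ?q \<Longrightarrow> \<not> le z f"
            by (auto simp: has_friend_iff not_above_part_iff)
          have "\<not> le z f" if z: "z \<in> set p" for z
          proof (cases "z \<in> T0")
            case True
            with z f(4) show ?thesis by simp
          next
            case False
            then have "z \<in> T1"
              using p z by blast
            then show ?thesis
              using le_trans[OF l_T1(4)[of z], of f] l_T1(3)[of z] f(1,2) x(1) X'U E'U by blast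
          qed
          with f(1,3) show ?thesis
            by (auto simp: has_friend_iff)
        next
          case False
          then have y: "y \<in> T1"
            using p by blast
          have "z \<in> T1" if "z \<in> set p" for z
          proof (rule ccontr)
            assume "z \<notin> T1"
            then have "l z < B"
              using p that l_T0(2) by blast
            moreover have "l y < l z"
              using p that by blast
            ultimately show False
              using l_T1(2)[OF y] by order
          qed
          then show ?thesis
            using p l_T1(1) y by (intro safe_linearisationD(4)[OF l1]) auto
        qed
      qed
      moreover have "T0 \<union> T1 \<subseteq> E'"
        using T0 T1 not_above_part_subset by blast
      moreover have "otype (T0 \<union> T1) \<le> M"
      proof -
        have "otype (T0 \<union> T1) \<le> otype T0 + otype T1"
          using \<open>T0 \<union> T1 \<subseteq> E'\<close> E'U by (intro otype_Un) auto
        also have "\<dots> \<le> M"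
          unfolding M by (rule add_mono[OF type0 type1])
        finally show ?thesis .
      qed
      ultimately show ?thesis by blast
    qed
  qed
  then show ?case
    using X'(1,2) safe_linearisation_mono by (meson subset_trans)
qed

section \<open>Antichains of multisets\<close>

definition msets :: "'a set \<Rightarrow> 'a multiset set" where
  "msets E = {m. set_mset m \<subseteq> E}"

abbreviation mincomparable :: "'a multiset \<Rightarrow> 'a multiset \<Rightarrow> bool" where
  "mincomparable \<equiv> incomparable (multiset_le le)"

abbreviation mwidth :: "'a multiset set \<Rightarrow> 'a ordinal multiset" where
  "mwidth Y \<equiv> width Y (multiset_le le)"

text \<open>The part of \<open>n\<close> above \<open>x\<close> is contained in \<open>m\<close>.  If \<open>x\<close> had no friend, the remaining part of \<open>n\<close>
  would lie below \<open>x\<close>, and \<open>n\<close> would be below \<open>m\<close>.\<close>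

lemma mincomparable_decompose:
  assumes "X \<subseteq> U" "m \<in> msets X" "n \<in> msets X" "mincomparable n m"
  obtains x p q where "x \<in># m" "has_friend X [] x" "p \<subseteq># m" "q \<in> msets (not_above X x)" "n = p + q"
proof -
  have "\<not> multiset_le le m n" "\<not> multiset_le le n m"
    using assms(4) by (auto simp: incomparable_def)
  then obtain x where x: "x \<in># m - m \<inter># n" "\<And>y. y \<in># n - m \<inter># n \<Longrightarrow> le x y \<Longrightarrow> x = y"
    unfolding multiset_le_def by blast
  have xm: "x \<in># m" "count n x < count m x"
    using in_diffD[OF x(1)] x(1) by (auto simp: in_diff_count)
  then have xX: "x \<in> X"
    using assms(2) by (auto simp: msets_def)
  have count_le: "count n y \<le> count m y" if "le x y" for y
  proof (rule ccontr)
    assume "\<not> ?thesis"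
    then have "y \<in># n - m \<inter># n"
      by (simp add: in_diff_count)
    with x(2)[OF this that] xm(2) \<open>\<not> ?thesis\<close> show False
      by simp
  qed
  let ?p = "filter_mset (le x) n" and ?q = "filter_mset (\<lambda>y. \<not> le x y) n"
  have "has_friend X [] x"
  proof (rule ccontr)
    assume "\<not> ?thesis"
    then have comp: "le x y \<or> le y x" if "y \<in> X" for y
      using that by (auto simp: has_friend_iff incomparable_def)
    have "\<exists>x\<in>#m - n \<inter># m. le y x \<and> y \<noteq> x" if "y \<in># n - n \<inter># m" for y
    proof -
      have "count m y < count n y" "y \<in># n"
        using that in_diffD[OF that] by (auto simp: in_diff_count)
      then have "\<not> le x y" "y \<in> X"
        using count_le[of y] assms(3) by (auto simp: msets_def)
      then have "le y x" "y \<noteq> x"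
        using comp[of y] le_refl[of x] xX assms(1) by auto
      moreover have "x \<in># m - n \<inter># m"
        using x(1) by (simp add: inf_commute)
      ultimately show ?thesis
        by blast
    qed
    with \<open>\<not> multiset_le le n m\<close> show False
      unfolding multiset_le_def by blast
  qed
  moreover have "?p \<subseteq># m"
    using count_le by (intro mset_subset_eqI) simp
  moreover have "?q \<in> msets (not_above X x)"
    using assms(3) by (auto simp: msets_def not_above_part_iff)
  moreover have "n = ?p + ?q"
    by (rule multiset_partition)
  ultimately show thesis
    using that xm(1) by blast
qed

text \<open>By \<open>mincomparable_decompose\<close> every other member is some
  \<open>p + q\<close> with finitely many choices of \<open>x\<close> and \<open>p\<close>. For
  fixed \<open>x\<close> and \<open>p\<close> the \<open>q\<close> form an antichain over the
  residual of \<open>x\<close>, so induction applies.\<close>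

lemma finite_antichain_msets:
  assumes "E \<subseteq> U" "A \<subseteq> msets E" "\<And>m n. m \<in> A \<Longrightarrow> n \<in> A \<Longrightarrow> m \<noteq> n \<Longrightarrow> mincomparable m n"
  shows "finite A"
  using assms
proof (induction E arbitrary: A rule: subset_induct)
  case (step E)
  show ?case
  proof (cases "A = {}")
    case False
    then obtain m where m: "m \<in> A" by blast
    have "A \<subseteq> insert m (\<Union>x\<in>set_mset m. \<Union>p\<in>{p. p \<subseteq># m}. (+) p ` {q \<in> msets (not_above E x). p + q \<in> A})"
    proof
      fix n assume n: "n \<in> A"
      show "n \<in> insert m (\<Union>x\<in>set_mset m. \<Union>p\<in>{p. p \<subseteq># m}. (+) p ` {q \<in> msets (not_above E x). p + q \<in> A})"
      proof (cases "n = m")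
        case False
        obtain x p q where "x \<in># m" "p \<subseteq># m" "q \<in> msets (not_above E x)" "n = p + q"
        proof (rule mincomparable_decompose[OF step.hyps(1)])
          show "m \<in> msets E" "n \<in> msets E" "mincomparable n m"
            using step.prems n m False by auto
        qed (rule that)
        with n show ?thesis by blast
      qed simp
    qed
    moreover have "finite {q \<in> msets (not_above E x). p + q \<in> A}" if x: "x \<in># m" for x p
    proof (rule step.IH)
      show "x \<in> E"
        using x m step.prems(1) by (auto simp: msets_def)
      fix q q' assume "q \<in> {q \<in> msets (not_above E x). p + q \<in> A}" "q' \<in> {q \<in> msets (not_above E x). p + q \<in> A}"
        "q \<noteq> q'"
      then show "mincomparable q q'"
        using step.prems(2)[of "p + q" "p + q'"] by simp
    qed auto
    then have "finite (insert m (\<Union>x\<in>set_mset m. \<Union>p\<in>{p. p \<subseteq># m}. (+) p ` {q \<in> msets (not_above E x). p + q \<in> A}))"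
      by (intro finite.insertI finite_UN_I finite_imageI finite_submultisets finite_set_mset)
    ultimately show ?thesis
      by (rule finite_subset)
  qed simp
qed

lemma wf_antichain_msets:
  assumes "Y \<subseteq> msets U"
  shows "wf (one_step_ext (antichain_seqs Y (multiset_le le)))"
proof (rule wf_one_step_extI, rule ccontr)
  fix f :: "nat \<Rightarrow> 'a multiset"
  assume "\<nexists>n. \<forall>p. p @ map f [0..<n] \<notin> antichain_seqs Y (multiset_le le)"
  then have f: "map f [0..<n] \<in> antichain_seqs Y (multiset_le le)" for n
    by (force simp: antichain_seqs_def sorted_wrt_append)
  have less: "mincomparable (f i) (f j)" if "i < j" for i j
    using f[of "Suc j"] that
    by (auto simp: antichain_seqs_def sorted_wrt_iff_nth_less simp del: upt_Suc dest!: spec[of _ i] spec[of _ j])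
  then have *: "mincomparable (f i) (f j)" if "i \<noteq> j" for i j
    using that by (metis incomparable_sym nat_neq_iff)
  have "inj f"
  proof (rule injI, rule ccontr)
    fix i j assume "f i = f j" "i \<noteq> j"
    then show False
      using *[of i j] by (simp add: incomparable_def)
  qed
  moreover have "finite (range f)"
  proof (rule finite_antichain_msets[of U])
    have "f i \<in> Y" for i
      using f[of "Suc i"] by (auto simp: antichain_seqs_def)
    then show "range f \<subseteq> msets U"
      using assms by blast
    show "mincomparable m n" if "m \<in> range f" "n \<in> range f" "m \<noteq> n" for m n
    proof -
      obtain i j where "m = f i" "n = f j"
        using \<open>m \<in> range f\<close> \<open>n \<in> range f\<close> by blast
      with *[of i j] \<open>m \<noteq> n\<close> show ?thesis by blast
    qed
  qed simp
  ultimately show False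
    by (simp add: finite_image_iff)
qed

section \<open>Widths of sets of multisets and the upper bound\<close>

lemma mwidth_less:
  assumes "Y \<subseteq> msets U" "y \<in> Y"
  shows "mwidth (incomparable_part Y (multiset_le le) y) < mwidth Y"
  unfolding width_def antichain_seqs_Cons[OF assms(2), symmetric]
  by (rule tree_rank_Nil_less[OF wf_antichain_msets[OF assms(1)] small_UNIV_multiset])
    (use assms in \<open>auto simp: antichain_seqs_def\<close>)

lemma mwidth_le:
  assumes "Y \<subseteq> msets U" "\<And>y. y \<in> Y \<Longrightarrow> mwidth (incomparable_part Y (multiset_le le) y) < M"
  shows "mwidth Y \<le> M"
  unfolding width_def
proof (rule tree_rank_Nil_le[OF wf_antichain_msets[OF assms(1)]])
  fix y assume "[y] \<in> antichain_seqs Y (multiset_le le)"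
  then have "y \<in> Y"
    by (simp add: antichain_seqs_def)
  with assms(2)[OF this]
  show "tree_rank {s. y # s \<in> antichain_seqs Y (multiset_le le)} [] < M"
    by (simp add: width_def antichain_seqs_Cons)
qed

lemma incomparable_part_subset: "incomparable_part Y R y \<subseteq> Y"
  by (auto simp: incomparable_part_def)

lemma mwidth_mono:
  assumes "A \<subseteq> B" "B \<subseteq> msets U"
  shows "mwidth A \<le> mwidth B"
  using assms
proof (induction "mwidth A" arbitrary: A B rule: less_induct)
  case less
  have A: "A \<subseteq> msets U"
    using less.prems by blast
  show ?case
  proof (rule mwidth_le[OF A])
    fix y assume y: "y \<in> A"
    have "mwidth (incomparable_part A (multiset_le le) y) \<le> mwidth (incomparable_part B (multiset_le le) y)"
      using less.prems y by (intro less.hyps[OF mwidth_less[OF A]]) (auto simp: incomparable_part_def)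
    also have "\<dots> < mwidth B"
      using less.prems y by (intro mwidth_less) auto
    finally show "mwidth (incomparable_part A (multiset_le le) y) < mwidth B" .
  qed
qed

lemma mwidth_Un:
  assumes "A \<subseteq> msets U" "B \<subseteq> msets U"
  shows "mwidth (A \<union> B) \<le> mwidth A + mwidth B"
  using assms
proof (induction "mwidth (A \<union> B)" arbitrary: A B rule: less_induct)
  case less
  let ?i = "\<lambda>Y y. incomparable_part Y (multiset_le le) y"
  have AB: "A \<union> B \<subseteq> msets U"
    using less.prems by blast
  show ?case
  proof (rule mwidth_le[OF AB])
    fix y assume y: "y \<in> A \<union> B"
    have eq: "?i (A \<union> B) y = ?i A y \<union> ?i B y"
      by (auto simp: incomparable_part_def)
    have "mwidth (?i (A \<union> B) y) \<le> mwidth (?i A y) + mwidth (?i B y)"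
      unfolding eq
      by (rule less.hyps[OF mwidth_less[OF AB y, unfolded eq]])
        (use less.prems in \<open>auto simp: incomparable_part_def\<close>)
    also have "\<dots> < mwidth A + mwidth B"
    proof -
      have mono: "mwidth (?i A y) \<le> mwidth A" "mwidth (?i B y) \<le> mwidth B"
        using less.prems by (intro mwidth_mono incomparable_part_subset; blast)+
      consider "y \<in> A" | "y \<in> B"
        using y by blast
      then show ?thesis
      proof cases
        case 1
        show ?thesis
          by (rule add_less_le_mono[OF mwidth_less[OF less.prems(1) 1] mono(2)])
      next
        case 2
        show ?thesis
          by (rule add_le_less_mono[OF mono(1) mwidth_less[OF less.prems(2) 2]])
      qed
    qed
    finally show "mwidth (?i (A \<union> B) y) < mwidth A + mwidth B" .
  qed
qed

lemma mwidth_finite_UN_less: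
  assumes "finite I" "\<And>i. i \<in> I \<Longrightarrow> F i \<subseteq> msets U" "\<And>i. i \<in> I \<Longrightarrow> mwidth (F i) < {#r#}"
  shows "mwidth (\<Union>i\<in>I. F i) < {#r#}"
  using assms
proof (induction I rule: finite_induct)
  case empty
  have "mwidth {} \<le> {#}"
    by (rule mwidth_le) auto
  moreover have "{#} < {#r#}"
    by simp
  ultimately have "mwidth {} < {#r#}"
    by order
  then show ?case
    by simp
next
  case (insert i I)
  have "mwidth (F i \<union> (\<Union>i\<in>I. F i)) \<le> mwidth (F i) + mwidth (\<Union>i\<in>I. F i)"
    using insert.prems(1) by (intro mwidth_Un) auto
  also have "mwidth (F i) < {#r#}" "mwidth (\<Union>i\<in>I. F i) < {#r#}"
    using insert.IH insert.prems by blast+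
  then have "mwidth (F i) + mwidth (\<Union>i\<in>I. F i) < {#r#}"
    by auto
  finally show ?case
    by simp
qed

lemma mwidth_add_left_le:
  assumes "Q \<subseteq> msets U" "(+) p ` Q \<subseteq> msets U"
  shows "mwidth ((+) p ` Q) \<le> mwidth Q"
  using assms
proof (induction "mwidth Q" arbitrary: Q rule: less_induct)
  case less
  show ?case
  proof (rule mwidth_le[OF less.prems(2)])
    fix m assume "m \<in> (+) p ` Q"
    then obtain q where q: "q \<in> Q" "m = p + q" by blast
    have eq: "incomparable_part ((+) p ` Q) (multiset_le le) m = (+) p ` incomparable_part Q (multiset_le le) q"
      by (auto simp: incomparable_part_def q(2))
    have "mwidth ((+) p ` incomparable_part Q (multiset_le le) q) \<le> mwidth (incomparable_part Q (multiset_le le) q)"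
      using less.prems incomparable_part_subset[of Q "multiset_le le" q]
      by (intro less.hyps[OF mwidth_less[OF less.prems(1) q(1)]]) blast+
    also have "\<dots> < mwidth Q"
      by (rule mwidth_less[OF less.prems(1) q(1)])
    finally show "mwidth (incomparable_part ((+) p ` Q) (multiset_le le) m) < mwidth Q"
      by (simp add: eq)
  qed
qed

lemma msets_mono: "E \<subseteq> E' \<Longrightarrow> msets E \<subseteq> msets E'"
  by (auto simp: msets_def)

text \<open>The friendly rank as an ordinal, so that it can be an exponent: \<open>{#rho X#}\<close>
  is \<omega> to that rank.\<close>

definition rho :: "'a set \<Rightarrow> 'a ordinal" where
  "rho X = multiset_rank (friendly_rank X X)"

lemma rho_less: "X \<subseteq> U \<Longrightarrow> x \<in> X \<Longrightarrow> has_friend X [] x \<Longrightarrow> rho (not_above X x) < rho X"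
  by (simp add: rho_def friendly_rank_less)

text \<open>After a move \<open>m\<close>, all that is left lies in finitely many translates of
  \<open>msets (not_above X x)\<close> with \<open>x\<close> a friendly element of \<open>m\<close>.
  Their widths have smaller exponents, and finite unions stay below
  \<open>{#rho X#}\<close>.\<close>

lemma mwidth_msets_le: "X \<subseteq> U \<Longrightarrow> mwidth (msets X) \<le> {#rho X#}"
proof (induction X rule: subset_induct)
  case (step X)
  have msets: "msets X \<subseteq> msets U"
    by (rule msets_mono[OF step.hyps(1)])
  show ?case
  proof (rule mwidth_le[OF msets])
    fix m assume m: "m \<in> msets X"
    define I where "I = {x \<in> set_mset m. has_friend X [] x} \<times> {p. p \<subseteq># m}"
    define F where "F = (\<lambda>(x, p). (+) p ` msets (not_above X x))"
    have sub: "F i \<subseteq> msets U" if "i \<in> I" for i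
      using that m step.hyps(1)
      by (force simp: F_def I_def msets_def not_above_part_iff dest: mset_subset_eqD)
    have less: "mwidth (F i) < {#rho X#}" if i: "i \<in> I" for i
    proof -
      obtain x p where xp: "i = (x, p)" "x \<in># m" "has_friend X [] x"
        using i by (auto simp: I_def)
      then have x: "x \<in> X"
        using m by (auto simp: msets_def)
      have "mwidth (F i) \<le> mwidth (msets (not_above X x))"
        using sub[OF i] step.hyps(1) not_above_part_subset[of X "[x]"] unfolding F_def xp(1) prod.case
        by (intro mwidth_add_left_le msets_mono) auto
      also have "\<dots> \<le> {#rho (not_above X x)#}"
        by (rule step.IH[OF x])
      also have "\<dots> < {#rho X#}"
        using rho_less[OF step.hyps(1) x xp(3)] by simp
      finally show ?thesis .
    qed
    have "incomparable_part (msets X) (multiset_le le) m \<subseteq> (\<Union>i\<in>I. F i)"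
    proof
      fix n assume "n \<in> incomparable_part (msets X) (multiset_le le) m"
      then have n: "n \<in> msets X" "mincomparable n m"
        by (auto simp: incomparable_part_def)
      obtain x p q where "x \<in># m" "has_friend X [] x" "p \<subseteq># m" "q \<in> msets (not_above X x)" "n = p + q"
        by (rule mincomparable_decompose[OF step.hyps(1) m n])
      then show "n \<in> (\<Union>i\<in>I. F i)"
        by (intro UN_I[of "(x, p)"]) (auto simp: I_def F_def)
    qed
    then have "mwidth (incomparable_part (msets X) (multiset_le le) m) \<le> mwidth (\<Union>i\<in>I. F i)"
      using sub by (intro mwidth_mono) auto
    also have "\<dots> < {#rho X#}"
      by (rule mwidth_finite_UN_less[OF _ sub less]) (auto simp: I_def finite_submultisets)
    finally show "mwidth (incomparable_part (msets X) (multiset_le le) m) < {#rho X#}" .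
  qed
qed

section \<open>The lower bound for the width\<close>

lemma ex_maximal:
  assumes "finite S" "S \<noteq> {}" "S \<subseteq> U"
  shows "\<exists>z\<in>S. \<forall>u\<in>S. le z u \<longrightarrow> u = z"
proof -
  let ?lt = "\<lambda>x y. le x y \<and> x \<noteq> y"
  have "transp_on S ?lt"
  proof (rule transp_onI)
    fix x y z assume *: "x \<in> S" "y \<in> S" "z \<in> S" "?lt x y" "?lt y z"
    then have "x \<in> U" "y \<in> U" "z \<in> U"
      using assms(3) by auto
    then show "?lt x z"
      using * le_trans[of x y z] le_antisym[of x y] by blast
  qed
  moreover have "asymp_on S ?lt"
  proof (rule asymp_onI)
    fix x y assume "x \<in> S" "y \<in> S" "?lt x y"
    then show "\<not> ?lt y x"
      using le_antisym[of x y] assms(3) by blast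
  qed
  ultimately have "\<exists>z\<in>S. \<forall>u\<in>S. u \<noteq> z \<longrightarrow> \<not> ?lt z u"
    using Finite_Set.bex_max_element[OF assms(1), of ?lt] assms(2) by blast
  then show ?thesis
    by blast
qed

text \<open>What is still playable after the multisets in \<open>F\<close>; a set suffices, since
  the order of moves does not matter.\<close>

definition avoiding :: "'a set \<Rightarrow> 'a multiset set \<Rightarrow> 'a multiset set" where
  "avoiding X F = {m \<in> msets X. \<forall>f\<in>F. mincomparable m f}"

lemma avoiding_subset: "avoiding X F \<subseteq> msets X"
  by (auto simp: avoiding_def)

lemma incomparable_part_avoiding:
  "incomparable_part (avoiding X F) (multiset_le le) m = avoiding X (insert m F)"
  by (auto simp: avoiding_def incomparable_part_def)

text \<open>The friend \<open>y\<close> of \<open>x\<close> is replaced by an element \<open>z\<close> above it that no element occurring in \<open>F\<close>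
  exceeds.  Trading one copy of \<open>x\<close> for many copies of \<open>z\<close> then makes the new multisets
  incomparable to \<open>F\<close>, whatever is added to them.\<close>

lemma ex_incomparable_translation:
  assumes X: "X \<subseteq> U" "x \<in> X" and y: "y \<in> X" "incomparable le y x"
    and F: "finite F" "F \<subseteq> msets (insert x (not_above X x))" "\<And>f. f \<in> F \<Longrightarrow> i < count f x"
  obtains p where "p \<in> msets (insert x (not_above X x))" "count p x = i"
    "\<And>q f. q \<in> msets (not_above X x) \<Longrightarrow> f \<in> F \<Longrightarrow> mincomparable (p + q) f"
proof -
  \<comment> \<open>Candidates for \<open>z\<close>; including \<open>y\<close> makes the set
    nonempty, so it has a maximal element.\<close>
  define S where "S = insert y {u \<in> \<Union> (set_mset ` F). le y u \<and> u \<noteq> x}"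
  have F_not_above: "u = x \<or> u \<in> not_above X x" if "u \<in># f" "f \<in> F" for u f
    using that F(2) by (auto simp: msets_def)
  have "finite S" "S \<noteq> {}"
    using F(1) by (auto simp: S_def)
  moreover have SX: "S \<subseteq> X"
    using y(1) F_not_above not_above_part_subset by (fastforce simp: S_def)
  ultimately obtain z where z: "z \<in> S" "\<And>u. u \<in> S \<Longrightarrow> le z u \<Longrightarrow> u = z"
    using ex_maximal[of S] X(1) by blast
  have zX: "z \<in> X" and yz: "le y z"
    using z(1) SX le_refl[of y] y(1) X(1) by (auto simp: S_def)
  have not_zx: "\<not> le z x"
    using le_trans[OF yz, of x] y X zX by (auto simp: incomparable_def)
  have not_xz: "\<not> le x z"
    using z(1) y(2) F_not_above by (auto simp: S_def incomparable_def not_above_part_iff)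
  have zx: "z \<noteq> x"
    using not_zx le_refl[of x] X by auto
  \<comment> \<open>With more copies of \<open>z\<close> than any \<open>f\<close> in
    \<open>F\<close> has, \<open>z\<close> witnesses that \<open>p + q\<close> is not below
    \<open>f\<close>; the surplus of \<open>x\<close> in \<open>f\<close> witnesses the
    converse.\<close>
  define n where "n = Suc (\<Sum>f\<in>F. count f z)"
  have n: "count f z < n" if "f \<in> F" for f
    using member_le_sum[of f F "\<lambda>f. count f z"] that F(1) by (simp add: n_def)
  define p where "p = replicate_mset i x + replicate_mset n z"
  have max: "u = z" if u: "u \<in># f" "f \<in> F" "le z u" for u f
  proof (rule z(2)[OF _ u(3)])
    have "u \<in> X" "u \<noteq> x"
      using F_not_above[OF u(1,2)] not_zx u(3) X(2) by (auto simp: not_above_part_iff)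
    moreover have "le y u"
      using le_trans[OF yz u(3)] y(1) zX \<open>u \<in> X\<close> X(1) by blast
    ultimately show "u \<in> S"
      using u by (auto simp: S_def)
  qed
  show thesis
  proof (rule that)
    show "p \<in> msets (insert x (not_above X x))"
      using zX not_xz by (auto simp: p_def msets_def not_above_part_iff split: if_splits)
    show "count p x = i"
      using zx by (simp add: p_def)
    fix q f assume q: "q \<in> msets (not_above X x)" and f: "f \<in> F"
    have "x \<notin> not_above X x"
      using le_refl[of x] X by (auto simp: not_above_part_iff)
    then have "x \<notin># q"
      using q by (auto simp: msets_def)
    then have count_x: "count (p + q) x = i"
      using zx by (simp add: p_def not_in_iff)
    have "\<not> multiset_le le (p + q) f"
    proof (rule not_multiset_leI)
      show "count f z < count (p + q) z"
        using n[OF f] zx by (simp add: p_def)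
    qed (use max f in blast)
    moreover have "\<not> multiset_le le f (p + q)"
    proof (rule not_multiset_leI)
      show "count (p + q) x < count f x"
        using F(3)[OF f] count_x by simp
      fix u assume "u \<in># p + q" "le x u"
      then show "u = x"
        using q not_xz by (auto simp: p_def msets_def not_above_part_iff split: if_splits)
    qed
    ultimately show "mincomparable (p + q) f"
      by (simp add: incomparable_def)
  qed
qed

text \<open>Each of \<open>i\<close> stages plays over the residual of \<open>x\<close>, translated
  by some \<open>p\<close>, and contributes a summand \<open>b\<close>. Each stage uses fewer copies
  of \<open>x\<close> than everything played before.\<close>

lemma replicate_le_mwidth_avoiding:
  assumes X: "X \<subseteq> U" "x \<in> X" and y: "y \<in> X" "incomparable le y x"
    and b: "mwidth (msets (not_above X x)) = {#b#}"
    and F: "finite F" "F \<subseteq> msets (insert x (not_above X x))" "\<And>f. f \<in> F \<Longrightarrow> i \<le> count f x"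
  shows "replicate_mset i b \<le> mwidth (avoiding X F)"
  using F
proof (induction i arbitrary: F)
  case (Suc i)
  let ?D = "not_above X x"
  have DX: "?D \<subseteq> X" "?D \<subseteq> U"
    using X(1) not_above_part_subset by blast+
  have mU: "msets X \<subseteq> msets U" "msets ?D \<subseteq> msets U"
    using X(1) DX by (auto intro!: msets_mono)
  \<comment> \<open>Exactly \<open>i\<close> copies of \<open>x\<close> are few enough for
    incomparability with \<open>F\<close> and enough for the \<open>i\<close> remaining
    stages.\<close>
  obtain p where p: "p \<in> msets (insert x ?D)" "count p x = i"
    "\<And>q f. q \<in> msets ?D \<Longrightarrow> f \<in> F \<Longrightarrow> mincomparable (p + q) f"
    by (rule ex_incomparable_translation[OF X y Suc.prems(1,2), of i])
      (use Suc.prems(3) Suc_le_eq that in auto)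
  \<comment> \<open>\<open>G\<close> collects the moves of the current stage before
    translation.\<close>
  have "replicate_mset i b + mwidth (avoiding ?D G) \<le> mwidth (avoiding X (F \<union> (+) p ` G))"
    if "finite G" "G \<subseteq> msets ?D" for G
    using that
  proof (induction "mwidth (avoiding ?D G)" arbitrary: G rule: less_induct)
    case less
    let ?R = "avoiding X (F \<union> (+) p ` G)"
    have R: "?R \<subseteq> msets U" and DG: "avoiding ?D G \<subseteq> msets U"
      using avoiding_subset mU by blast+
    have le: "replicate_mset i b \<le> mwidth ?R"
    proof (rule Suc.IH)
      show "F \<union> (+) p ` G \<subseteq> msets (insert x ?D)"
        using Suc.prems(2) less.prems(2) p(1) unfolding msets_def by (auto dest!: subsetD)
      show "i \<le> count f x" if "f \<in> F \<union> (+) p ` G" for f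
        using that Suc.prems(3) p(2) by fastforce
    qed (use Suc.prems(1) less.prems(1) in simp)
    show ?case
    proof (rule ccontr)
      assume "\<not> ?thesis"
      then have lt: "mwidth ?R < replicate_mset i b + mwidth (avoiding ?D G)"
        by (simp only: not_le)
      have "mwidth (avoiding ?D G) \<le> {#b#}"
        using mwidth_mono[OF avoiding_subset mU(2)] unfolding b .
      then have ub: "u \<le> b" if "u \<in># mwidth (avoiding ?D G)" for u
        using that by auto
      \<comment> \<open>A move \<open>q\<close> over \<open>?D\<close> leaves at least
        \<open>N\<close>. Then \<open>p + q\<close> is a move in \<open>?R\<close> that leaves the
        whole width of \<open>?R\<close>, which is impossible.\<close>
      obtain N where N: "mwidth ?R = replicate_mset i b + N" "N < mwidth (avoiding ?D G)"
        by (rule ordinal_multiset_remainder[OF _ le lt]) (use ub in \<open>auto split: if_splits\<close>)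
      then obtain q where q: "q \<in> avoiding ?D G" "N \<le> mwidth (avoiding ?D (insert q G))"
        using mwidth_le[OF DG, of N] unfolding incomparable_part_avoiding by (meson not_le)
      have qD: "q \<in> msets ?D"
        using q(1) by (simp add: avoiding_def)
      have "replicate_mset i b + N \<le> replicate_mset i b + mwidth (avoiding ?D (insert q G))"
        by (rule add_left_mono[OF q(2)])
      also have "\<dots> \<le> mwidth (avoiding X (F \<union> (+) p ` insert q G))"
        using less.prems qD mwidth_less[OF DG q(1)]
        by (intro less.hyps) (auto simp: incomparable_part_avoiding)
      also have "F \<union> (+) p ` insert q G = insert (p + q) (F \<union> (+) p ` G)"
        by blast
      also have "mwidth (avoiding X \<dots>) < mwidth ?R"
        unfolding incomparable_part_avoiding[symmetric]
      proof (rule mwidth_less[OF R])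
        have "p + q \<in> msets X"
          using p(1) qD X(2) DX(1) by (auto simp: msets_def)
        then show "p + q \<in> ?R"
          using p(3)[OF qD] q(1) by (auto simp: avoiding_def)
      qed
      finally show False
        using N(1) by simp
    qed
  qed
  from this[of "{}"] show ?case
    by (simp add: avoiding_def b)
qed simp

text \<open>If the width were below \<open>{#rho X#}\<close>, its largest exponent would be at most
  \<open>?b\<close>, the exponent for the residual of some friendly \<open>x\<close>. Any finite
  number of stages over this residual can be played, so the width would exceed itself.\<close>

lemma mwidth_msets: "X \<subseteq> U \<Longrightarrow> mwidth (msets X) = {#rho X#}"
proof (induction X rule: subset_induct)
  case (step X)
  let ?W = "mwidth (msets X)"
  show ?case
  proof (rule order.antisym[OF mwidth_msets_le[OF step.hyps(1)]], rule ccontr)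
    assume "\<not> {#rho X#} \<le> ?W"
    then have W: "?W < {#rho X#}"
      by (simp only: not_le)
    \<comment> \<open>The empty multiset is a possible move, so the width is not 0 and has a largest
      exponent.\<close>
    have "{#} \<in> msets X"
      by (simp add: msets_def)
    then have "?W \<noteq> {#}"
      using mwidth_less[OF msets_mono[OF step.hyps(1)], of "{#}"] by auto
    then have "Max_mset ?W < rho X"
      using W by auto
    then obtain N where N: "N < friendly_rank X X" "multiset_rank N = Max_mset ?W"
      unfolding rho_def by (rule less_multiset_rankE)
    then obtain x where x: "x \<in> X" "has_friend X [] x" "N \<le> friendly_rank (not_above X x) (not_above X x)"
      using friendly_rank_le[OF step.hyps(1), of X N] by (meson not_le)
    let ?b = "rho (not_above X x)"
    have "Max_mset ?W \<le> ?b"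
      unfolding rho_def N(2)[symmetric]
      using x(3) by (simp add: strict_mono_less_eq[OF strict_mono_multiset_rank])
    then have "u \<le> ?b" if "u \<in># ?W" for u
      using that by (meson Max_ge finite_set_mset order.trans)
    then have "?W < replicate_mset (Suc (size ?W)) ?b"
      by (rule less_replicate_mset)
    also obtain y where "y \<in> X" "incomparable le y x"
      using x(2) by (auto simp: has_friend_iff)
    then have "replicate_mset (Suc (size ?W)) ?b \<le> mwidth (avoiding X {})"
      by (intro replicate_le_mwidth_avoiding[OF step.hyps(1) x(1) _ _ step.IH[OF x(1)]]) auto
    finally show False
      by (simp add: avoiding_def)
  qed
qed

section \<open>Translation back to ordinals\<close>

lemma max_order_type_eq:
  assumes "T \<subseteq> U"
  shows "max_order_type T le = multiset_rank (otype T)"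
proof -
  have "bad_seqs_such_that (\<lambda>_ _. True) T = bad_seqs T le"
    by (simp add: bad_seqs_such_that_def)
  with wf_bad_seqs_such_that[OF assms, of "\<lambda>_ _. True"] show ?thesis
    unfolding max_order_type_def otype_eq by (intro tree_rank_ordinal small_UNIV) simp
qed

end

theorem mainTheorem12:
  fixes X :: "'a set" and le :: "'a \<Rightarrow> 'a \<Rightarrow> bool"
  assumes "wpo_on X le"
  shows "(width {m. set_mset m \<subseteq> X} (multiset_le le) :: 'a ordinal) =
    omega_power (max_safe_order_type X le)"
proof -
  interpret well_partial_order X le
    by (rule well_partial_order.intro[OF assms])
  have "width (msets X) (multiset_le le) = multiset_rank (mwidth (msets X))"
    unfolding width_def
    by (rule tree_rank_ordinal[OF wf_antichain_msets[OF order_refl] small_UNIV_multiset])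
  also have "\<dots> = omega_power (rho X)"
    by (simp add: mwidth_msets multiset_rank_single)
  also have "rho X = max_safe_order_type X le"
    unfolding max_safe_order_type_def
  \<comment> \<open>The supremum is attained: some safe set has type \<open>rho X\<close>, and none
    has a larger type.\<close>
  proof (rule cSup_eq_maximum[symmetric])
    obtain T l where T: "T \<subseteq> X" "safe_linearisation X T l (friendly_rank X X)"
      "otype T \<le> friendly_rank X X"
      using ex_safe_linearisation[OF order_refl order_refl order_refl] by blast
    have "friendly_rank X X \<le> friendly_rank X T"
      by (rule safe_linearisation_le_friendly_rank[OF T(2) order_refl])
    \<comment> \<open>The bounds on \<open>otype T\<close> from both sides meet, so the
      linearisation of \<open>T\<close> is maximal.\<close>
    with T(3) friendly_rank_le_type[OF T(1), of X] have otype: "otype T = friendly_rank X X"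
      by order
    then have ot: "max_order_type T le = rho X"
      by (simp add: max_order_type_eq[OF T(1)] rho_def)
    have "bij_betw (multiset_rank \<circ> l) T {..<rho X}"
    proof (rule bij_betw_trans[OF safe_linearisationD(2)[OF T(2)]])
      show "bij_betw multiset_rank {..<friendly_rank X X} {..<rho X}"
        unfolding bij_betw_def rho_def multiset_rank_image_lessThan by (simp add: inj_on_def)
    qed
    then have "max_linearisation T le (multiset_rank \<circ> l)"
      using safe_linearisationD(3)[OF T(2)] by (auto simp: max_linearisation_def ot)
    then have "safe X le T"
      using T(1) safe_linearisationD(4)[OF T(2)] unfolding safe_def has_friend_def
      by (intro conjI exI[of _ "multiset_rank \<circ> l"]) auto
    with ot show "rho X \<in> {max_order_type T le |T. safe X le T}"
      by force
  next
    fix \<alpha> assume "\<alpha> \<in> {max_order_type T le :: 'a ordinal |T. safe X le T}"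
    then obtain T where \<alpha>: "\<alpha> = max_order_type T le" and T: "safe X le T"
      by blast
    then obtain l where TX: "T \<subseteq> X" and lin: "max_linearisation T le l"
      and friend: "\<forall>p x. set p \<subseteq> T \<and> x \<in> T \<and> (\<forall>y\<in>set p. l x < l y) \<longrightarrow> has_friend X p x"
      unfolding safe_def has_friend_def by blast
    from lin friend have l: "bij_betw l T {..<max_order_type T le}"
      "\<And>y z. y \<in> T \<Longrightarrow> z \<in> T \<Longrightarrow> le y z \<Longrightarrow> y \<noteq> z \<Longrightarrow> l y < l z"
      "\<And>p x. set p \<subseteq> T \<Longrightarrow> x \<in> T \<Longrightarrow> (\<And>y. y \<in> set p \<Longrightarrow> l x < l y) \<Longrightarrow> has_friend X p x"
      unfolding max_linearisation_def by blast+
    \<comment> \<open>The linearisation is pulled back to normal forms; its values lie below the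
      maximal order type of \<open>T\<close>, hence in the range of
      \<open>multiset_rank\<close>.\<close>
    let ?l = "the_inv multiset_rank \<circ> l"
    have inj: "inj (multiset_rank :: 'a ordinal multiset \<Rightarrow> 'a ordinal)"
      by (rule injI) simp
    have l_eq: "multiset_rank (?l x) = l x" if "x \<in> T" for x
    proof -
      have "l x < multiset_rank (otype T)"
        using l(1) that by (auto simp: bij_betw_def max_order_type_eq[OF TX])
      then obtain N where "multiset_rank N = l x"
        by (rule less_multiset_rankE)
      then show ?thesis
        by (auto simp: the_inv_f_f[OF inj] simp flip: \<open>multiset_rank N = l x\<close>)
    qed
    have less: "?l x < ?l y \<longleftrightarrow> l x < l y" if "x \<in> T" "y \<in> T" for x y
      using multiset_rank_less_iff[of "?l x" "?l y"] that by (simp only: l_eq)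
    have "safe_linearisation X T ?l (otype T)"
      unfolding safe_linearisation_def
    proof (intro conjI ballI allI impI)
      have "bij_betw (multiset_rank \<circ> ?l) T (multiset_rank ` {..<otype T})"
        using l(1) by (subst bij_betw_cong[of T _ l])
          (auto simp: l_eq[unfolded comp_def] max_order_type_eq[OF TX] multiset_rank_image_lessThan)
      then have "inj_on (multiset_rank \<circ> ?l) T" "multiset_rank ` ?l ` T = multiset_rank ` {..<otype T}"
        by (simp_all add: bij_betw_def image_comp)
      then show "bij_betw ?l T {..<otype T}"
        by (simp add: bij_betw_def inj_on_imageI2 inj_image_eq_iff[OF inj])
      show "?l y < ?l z" if "y \<in> T" "z \<in> T" "le y z \<and> y \<noteq> z" for y z
        using that less l(2) by blast
      show "has_friend X p x" if "set p \<subseteq> T \<and> x \<in> T \<and> (\<forall>y\<in>set p. ?l x < ?l y)" for p x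
        using that less l(3) by blast
    qed (use TX in blast)
    then have "otype T \<le> friendly_rank X T"
      by (rule safe_linearisation_le_friendly_rank[OF _ order_refl])
    also have "\<dots> \<le> friendly_rank X X"
      using TX by (intro friendly_rank_mono) auto
    finally show "\<alpha> \<le> rho X"
      unfolding \<alpha> max_order_type_eq[OF TX] rho_def
      by (simp add: strict_mono_less_eq[OF strict_mono_multiset_rank])
  qed
  finally show ?thesis
    by (simp add: msets_def)
qed

end
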